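(* Let $q$ be an odd prime power and $d\ge1$. Let $\mathcal H_q^d$ be the orthogonal sum of $d$ hyperbolic planes over $\mathbb F_q$ and $\mathcal I$ a fixed $d$-dimensional totally isotropic subspace of it. Then $$\sum_{F\in\mathcal{WF}^e(\mathcal H^d_q)}t^{w(F)}=M_d^D\prod_{j=1}^d\frac{1}{1-t^j},\qquad M_d^D=\sum_{\sigma\in\mathcal S_d^D}q^{l^D(\sigma)}t^{\mathrm{Wmaj}(\sigma)}.$$
   Context: The hyperbolic plane over $\mathbb F_q$ is $\mathbb F_q^2$ with quadratic form $(x,y)\mapsto xy$. A subspace is isotropic if the quadratic form vanishes on it. A flag of $\mathcal H_q^d$ is a strictly increasing sequence $V_1\subset\dots\subset V_k$ ($k\ge0$) of nonzero isotropic subspaces; it is even if $\dim V_k-\dim(V_k\cap\mathcal I)$ is even (the empty flag is even). A weighted flag carries strictly positive integers $w_1,\dots,w_k$, weight $w(F)=\sum_iw_i\dim V_i$. $\mathcal{WF}^e(\mathcal H^d_q)$ is the set of weighted even flags. $\mathcal S_d^D$ is the group of permutations $\sigma$ of $\{\pm1,\dots,\pm d\}$ with $\sigma(-i)=-\sigma(i)$ and an even number of $i\in\{1,\dots,d\}$ with $\sigma(i)<0$. $l^D(\sigma)=\#\{0<i<j\le d:\sigma(i)\sigma(j)(\sigma(i)-\sigma(j))>0\}+\sum_{1\le i\le d,\sigma(i)<0}(d+\sigma(i))$ and $\mathrm{Wmaj}(\sigma)=\sum_{1\le i<d,\ \sigma(i)>\sigma(i+1)}i+\#\{1\le i\le d:\sigma(i)<0\}$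 (usual order on integers). *)

theory Defs
  imports "HOL-Analysis.Analysis" "HOL-Computational_Algebra.Formal_Power_Series"
begin

text \<open>
  The orthogonal sum of \<open>d = CARD('d)\<close> hyperbolic planes over \<open>'a\<close> is modelled on
  \<open>'a ^ ('d + 'd)\<close>: the coordinates \<open>Inl i\<close> and \<open>Inr i\<close> belong to the \<open>i\<close>-th plane.
\<close>

definition hyp_plane_form :: "'a::field \<times> 'a \<Rightarrow> 'a" where
  "hyp_plane_form = (\<lambda>(x, y). x * y)"

definition hyp_form :: "'a::field ^ ('d::finite + 'd) \<Rightarrow> 'a" where
  "hyp_form v = (\<Sum>i\<in>UNIV. hyp_plane_form (v $ Inl i, v $ Inr i))"

definition isotropic :: "('a::field ^ ('d::finite + 'd)) set \<Rightarrow> bool" where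
  "isotropic V \<longleftrightarrow> vec.subspace V \<and> (\<forall>v\<in>V. hyp_form v = 0)"

definition flag :: "('a::field ^ ('d::finite + 'd)) set list \<Rightarrow> bool" where
  "flag Vs \<longleftrightarrow> sorted_wrt (\<subset>) Vs \<and> (\<forall>V\<in>set Vs. isotropic V \<and> V \<noteq> {0})"

text \<open>The natural-number subtraction below never truncates, as \<open>V \<inter> I \<subseteq> V\<close>.\<close>

definition even_flag ::
  "('a::field ^ ('d::finite + 'd)) set \<Rightarrow> ('a ^ ('d + 'd)) set list \<Rightarrow> bool" where
  "even_flag I Vs \<longleftrightarrow> flag Vs \<and>
     (Vs \<noteq> [] \<longrightarrow> even (vec.dim (last Vs) - vec.dim (last Vs \<inter> I)))"

definition weighted_even_flags ::
  "('a::field ^ ('d::finite + 'd)) set \<Rightarrow> (('a ^ ('d + 'd)) set \<times> nat) list set" where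
  "weighted_even_flags I = {F. even_flag I (map fst F) \<and> (\<forall>w\<in>set (map snd F). w > 0)}"

definition flag_weight :: "(('a::field ^ ('d::finite + 'd)) set \<times> nat) list \<Rightarrow> nat" where
  "flag_weight F = (\<Sum>(V, w)\<leftarrow>F. w * vec.dim V)"

definition even_signed_perms :: "nat \<Rightarrow> (int \<Rightarrow> int) set" where
  "even_signed_perms d = {\<sigma>. \<sigma> permutes ({- int d..int d} - {0}) \<and>
     (\<forall>i\<in>{- int d..int d} - {0}. \<sigma> (- i) = - \<sigma> i) \<and>
     even (card {i\<in>{1..int d}. \<sigma> i < 0})}"

text \<open>
  For \<open>\<sigma>\<close> a signed permutation all arguments of \<open>nat\<close> in the next two definitions are
  nonnegative.
\<close>

definition length_D :: "nat \<Rightarrow> (int \<Rightarrow> int) \<Rightarrow> nat" where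
  "length_D d \<sigma> =
     card {(i, j). 0 < i \<and> i < j \<and> j \<le> int d \<and> \<sigma> i * \<sigma> j * (\<sigma> i - \<sigma> j) > 0} +
     (\<Sum>i\<in>{i\<in>{1..int d}. \<sigma> i < 0}. nat (int d + \<sigma> i))"

definition Wmaj :: "nat \<Rightarrow> (int \<Rightarrow> int) \<Rightarrow> nat" where
  "Wmaj d \<sigma> =
     (\<Sum>i\<in>{i\<in>{1..<int d}. \<sigma> i > \<sigma> (i + 1)}. nat i) + card {i\<in>{1..int d}. \<sigma> i < 0}"

definition M_D :: "nat \<Rightarrow> nat \<Rightarrow> rat fps" where
  "M_D q d = (\<Sum>\<sigma>\<in>even_signed_perms d. fps_const (of_nat q ^ length_D d \<sigma>) * fps_X ^ Wmaj d \<sigma>)"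

end

theory Submission
  imports Defs
begin

text \<open>
  Both sides are the generating function of words \<open>c\<close> of length \<open>d\<close> over the integers with an even
  number of negative letters, where \<open>c\<close> has weight the sum of the absolute values of its letters and
  carries the factor \<open>q ^ stat c\<close> for a statistic that is a sum over pairs of letters.

  Sorting the signed labels \<open>1, \<dots>, d\<close> by decreasing letter, with ties broken by the label, yields an
  even signed permutation \<open>\<sigma>\<close> together with a weakly decreasing sequence that drops at the descents
  of \<open>\<sigma>\<close>. This is a bijection, \<open>stat c\<close> becomes the length of \<open>\<sigma>\<close>, and summing over the decreasing
  sequences gives the right-hand side.

  For the left-hand side, lowering the weight of the top subspace by one identifies the flags with
  top \<open>V\<close> with all weighted flags inside \<open>V\<close>. On words this is the passage from \<open>c\<close> to the word of its
  nonzero letters, made positive and lowered by one. So it remains to compare the number of isotropic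
  \<open>V\<close> of dimension \<open>p + m\<close> that meet \<open>I\<close> in dimension \<open>p\<close> with the sum over sign patterns with \<open>p\<close>
  pluses and \<open>m\<close> minuses; both equal
  \<open>[z + p + m]! / ([z]! [p]! [m]!) * q ^ (m (m - 1) / 2 + m z)\<close> for \<open>z = d - p - m\<close>.
\<close>

section \<open>Generating functions of weighted sets\<close>

text \<open>No closed form of \<open>word_gf\<close> is ever computed. Flags with top V contribute
  t^(dim V) times a series that depends on dim V alone, so the flag side is a combination of the
  series t^k \<open>word_gf q k\<close>, weighted by the numbers of V of each type (p, m); integer
  words expand in the same way, with sign patterns in place of subspaces. Restricted to m = 0, the
  expansion of words becomes a recursion for \<open>word_gf\<close> with Gaussian binomials as
  coefficients. Flags inside V satisfy this recursion too, so the two series agree by induction on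
  the dimension. Parity means m even throughout: m is the number of negative values of \<sigma>, the
  number of negative letters, and dim V - dim (V \<inter> I). A negative letter - a - 1 stands for
  the value a. This shift prevents ties between a label and its negative, and it is the source of
  the count of negatives in \<open>Wmaj\<close>. The count of isotropic V rests on one observation:
  the form vanishes on I, so on a coset of I the quadratic condition is affine linear.\<close>

definition gf :: "'x set \<Rightarrow> ('x \<Rightarrow> nat) \<Rightarrow> ('x \<Rightarrow> rat) \<Rightarrow> rat fps" where
  "gf A w f = Abs_fps (\<lambda>n. \<Sum>x\<in>{x\<in>A. w x = n}. f x)"

text \<open>A sum over an infinite set is 0 in HOL, so \<open>gf\<close> is total, but splitting it
  as in \<open>gf_partition\<close> and \<open>gf_Times\<close> requires each weight to be attained
  finitely often.\<close>

definition finite_fibres :: "'x set \<Rightarrow> ('x \<Rightarrow> nat) \<Rightarrow> bool" where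
  "finite_fibres A w \<longleftrightarrow> (\<forall>n. finite {x\<in>A. w x = n})"

lemma finite_fibres_subset: "finite_fibres B w \<Longrightarrow> A \<subseteq> B \<Longrightarrow> finite_fibres A w"
  unfolding finite_fibres_def by (auto intro: finite_subset[of "{x\<in>A. w x = _}" "{x\<in>B. w x = _}"])

lemma finite_fibres_image:
  assumes "finite_fibres A w" "B \<subseteq> h ` A" "\<And>x. x \<in> A \<Longrightarrow> w' (h x) = w x"
  shows "finite_fibres B w'"
  unfolding finite_fibres_def
proof
  fix n
  have "{y\<in>B. w' y = n} \<subseteq> h ` {x\<in>A. w x = n}" using assms by auto
  then show "finite {y\<in>B. w' y = n}"
    using assms(1) finite_surj unfolding finite_fibres_def by blast
qed

lemma finite_fibres_add:
  "finite_fibres A w \<Longrightarrow> finite_fibres A (\<lambda>x. k + w x)"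
proof -
  assume *: "finite_fibres A w"
  have "{x\<in>A. k + w x = n} \<subseteq> {x\<in>A. w x = n - k}" for n by auto
  then show ?thesis using * unfolding finite_fibres_def by (meson finite_subset)
qed

lemma finite_fibres_Times:
  assumes "finite_fibres A v" "finite_fibres B w"
  shows "finite_fibres (A \<times> B) (\<lambda>(x, y). v x + w y)"
  unfolding finite_fibres_def
proof
  fix n
  have "{p\<in>A \<times> B. (\<lambda>(x, y). v x + w y) p = n}
      \<subseteq> (\<Union>i\<le>n. {x\<in>A. v x = i} \<times> {y\<in>B. w y = n - i})" by auto
  moreover have "finite (\<Union>i\<le>n. {x\<in>A. v x = i} \<times> {y\<in>B. w y = n - i})"
    using assms unfolding finite_fibres_def by auto
  ultimately show "finite {p\<in>A \<times> B. (\<lambda>(x, y). v x + w y) p = n}" by (rule finite_subset)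
qed

lemma gf_bij_betw:
  assumes "bij_betw h A B" "\<And>x. x \<in> A \<Longrightarrow> w' (h x) = w x" "\<And>x. x \<in> A \<Longrightarrow> f' (h x) = f x"
  shows "gf A w f = gf B w' f'"
proof -
  have "(\<Sum>x\<in>{x\<in>A. w x = n}. f x) = (\<Sum>y\<in>{y\<in>B. w' y = n}. f' y)" for n
  proof -
    have "bij_betw h {x\<in>A. w x = n} {y\<in>B. w' y = n}"
      using assms(1,2) unfolding bij_betw_def by (auto intro: inj_on_subset)
    moreover have "sum f {x\<in>A. w x = n} = (\<Sum>x\<in>{x\<in>A. w x = n}. f' (h x))"
      using assms(3) by (intro sum.cong) auto
    ultimately show ?thesis by (simp add: sum.reindex_bij_betw)
  qed
  then show ?thesis unfolding gf_def by simp
qed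

lemma gf_scale_shift:
  "gf A (\<lambda>x. k + w x) (\<lambda>x. c * f x) = fps_const c * fps_X ^ k * gf A w f"
proof (rule fps_ext)
  fix n
  have "{x\<in>A. k + w x = n} = (if n < k then {} else {x\<in>A. w x = n - k})" by auto
  then show "fps_nth (gf A (\<lambda>x. k + w x) (\<lambda>x. c * f x)) n = fps_nth (fps_const c * fps_X ^ k * gf A w f) n"
    by (simp add: gf_def fps_X_power_mult_nth mult.assoc sum_distrib_left)
qed

lemma gf_shift: "gf A (\<lambda>x. k + w x) f = fps_X ^ k * gf A w f"
  using gf_scale_shift[of A k w 1 f] by simp

lemma gf_partition:
  assumes "finite_fibres A w" "finite K" "g ` A \<subseteq> K"
  shows "gf A w f = (\<Sum>k\<in>K. gf {x\<in>A. g x = k} w f)"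
proof (rule fps_ext)
  fix n
  have "(\<Sum>x\<in>{x\<in>A. w x = n}. f x) = (\<Sum>k\<in>K. \<Sum>x\<in>{x. x \<in> {x\<in>A. w x = n} \<and> g x = k}. f x)"
    using assms by (intro sum.group[symmetric]) (auto simp: finite_fibres_def)
  also have "\<dots> = (\<Sum>k\<in>K. \<Sum>x\<in>{x \<in> {x\<in>A. g x = k}. w x = n}. f x)"
    by (intro sum.cong) auto
  finally show "fps_nth (gf A w f) n = fps_nth (\<Sum>k\<in>K. gf {x\<in>A. g x = k} w f) n"
    by (simp add: gf_def fps_sum_nth)
qed

lemma gf_Times:
  assumes "finite_fibres A v" "finite_fibres B w"
  shows "gf (A \<times> B) (\<lambda>(x, y). v x + w y) (\<lambda>(x, y). f x * g y) = gf A v f * gf B w g"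
proof (rule fps_ext)
  fix n
  let ?S = "{p\<in>A \<times> B. (\<lambda>(x, y). v x + w y) p = n}"
  have fin: "finite ?S"
    using finite_fibres_Times[OF assms] unfolding finite_fibres_def by blast
  have "(\<Sum>p\<in>?S. (\<lambda>(x, y). f x * g y) p)
      = (\<Sum>i\<in>{0..n}. \<Sum>p\<in>{p. p \<in> ?S \<and> v (fst p) = i}. (\<lambda>(x, y). f x * g y) p)"
    using fin by (intro sum.group[symmetric]) auto
  also have "\<dots> = (\<Sum>i\<in>{0..n}. \<Sum>p\<in>{x\<in>A. v x = i} \<times> {y\<in>B. w y = n - i}. (\<lambda>(x, y). f x * g y) p)"
    by (intro sum.cong) auto
  also have "\<dots> = (\<Sum>i\<in>{0..n}. (\<Sum>x\<in>{x\<in>A. v x = i}. f x) * (\<Sum>y\<in>{y\<in>B. w y = n - i}. g y))"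
    by (simp add: sum_product sum.cartesian_product)
  finally show "fps_nth (gf (A \<times> B) (\<lambda>(x, y). v x + w y) (\<lambda>(x, y). f x * g y)) n
      = fps_nth (gf A v f * gf B w g) n"
    by (simp add: gf_def fps_mult_nth)
qed

lemma gf_singleton: "gf {x} w f = fps_const (f x) * fps_X ^ w x"
proof (rule fps_ext)
  fix n
  have "{y\<in>{x}. w y = n} = (if w x = n then {x} else {})" by auto
  then show "fps_nth (gf {x} w f) n = fps_nth (fps_const (f x) * fps_X ^ w x) n"
    by (simp add: gf_def fps_X_power_mult_nth)
qed

lemma finite_fibres_mult: "j > 0 \<Longrightarrow> finite_fibres (UNIV :: nat set) (\<lambda>n. j * n)"
  unfolding finite_fibres_def
proof
  fix n assume j: "j > (0::nat)"
  have "{x\<in>UNIV. j * x = n} \<subseteq> {..n}" using j by auto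
  then show "finite {x\<in>UNIV. j * x = n}" using finite_subset by blast
qed

text \<open>Splitting off n = 0 and shifting the rest by \<open>Suc\<close> gives G = t^j G + 1. The
  resulting G (1 - t^j) = 1 also shows that the divisor is nonzero.\<close>

lemma gf_geometric:
  assumes "j > 0"
  shows "gf (UNIV :: nat set) (\<lambda>n. j * n) (\<lambda>_. 1) = 1 / (1 - fps_X ^ j)"
proof -
  let ?G = "gf (UNIV :: nat set) (\<lambda>n. j * n) (\<lambda>_. 1)"
  have "?G = (\<Sum>b\<in>UNIV. gf {x\<in>UNIV. (x = 0) = b} (\<lambda>n. j * n) (\<lambda>_. 1))"
    using finite_fibres_mult[OF assms] by (intro gf_partition) auto
  also have "\<dots> = gf {x. x \<noteq> 0} (\<lambda>n. j * n) (\<lambda>_. 1) + gf {0} (\<lambda>n. j * n) (\<lambda>_. 1)"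
    by (simp add: UNIV_bool)
  also have "gf {x. x \<noteq> (0::nat)} (\<lambda>n. j * n) (\<lambda>_. 1) = gf UNIV (\<lambda>n. j + j * n) (\<lambda>_. 1)"
    by (rule gf_bij_betw[symmetric, of Suc]) (auto simp: bij_betw_def image_iff gr0_conv_Suc)
  finally have "?G = fps_X ^ j * ?G + 1" by (simp add: gf_shift gf_singleton)
  then have "?G * (1 - fps_X ^ j) = 1" by (simp add: algebra_simps)
  moreover from this have "(1 - fps_X ^ j :: rat fps) \<noteq> 0" by fastforce
  ultimately show ?thesis
    using nonzero_mult_div_cancel_right[of "1 - fps_X ^ j" ?G] by simp
qed

text \<open>Convergence of formal power series is coefficientwise, and only the elements of weight n
  touch the n-th coefficient.\<close>

lemma has_sum_fps_X_power:
  assumes "finite_fibres A w"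
  shows "((\<lambda>x. fps_X ^ w x) has_sum gf A w (\<lambda>_. 1)) A"
proof (rule has_sum_fpsI)
  have eq: "{x\<in>A. fps_nth (fps_X ^ w x :: rat fps) n \<noteq> 0} = {x\<in>A. w x = n}" for n
    by (auto simp: fps_X_power_nth)
  show "finite {x\<in>A. fps_nth (fps_X ^ w x :: rat fps) n \<noteq> 0}" for n
    using assms unfolding eq finite_fibres_def by blast
  show "fps_nth (gf A w (\<lambda>_. 1)) n = (\<Sum>x\<in>{x\<in>A. fps_nth (fps_X ^ w x :: rat fps) n \<noteq> 0}. fps_nth (fps_X ^ w x) n)" for n
    unfolding eq by (simp add: gf_def fps_X_power_nth)
qed

section \<open>Integer words and their sign patterns\<close>

text \<open>The length of the sorting permutation, read off the word. A negative letter pays one for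
  each later letter, which is its term d + \<sigma>(i) in \<open>length_D\<close>; the filters count
  inversions between labels.\<close>

fun stat :: "int list \<Rightarrow> nat" where
  "stat [] = 0"
| "stat (x # xs) = (if 0 \<le> x then length (filter (\<lambda>y. x < \<bar>y\<bar>) xs)
      else length xs + length (filter (\<lambda>y. \<bar>y\<bar> < \<bar>x\<bar>) xs)) + stat xs"

fun noninv :: "nat list \<Rightarrow> nat" where
  "noninv [] = 0"
| "noninv (x # xs) = length (filter (\<lambda>y. x < y) xs) + noninv xs"

text \<open>The letters are listed by label in the order \<open>1, \<dots>, d, - d, \<dots>, - 1\<close>: with respect to this order
  the first term of \<^const>\<open>length_D\<close> counts inversions.\<close>

fun collapse :: "int list \<Rightarrow> nat list" where
  "collapse [] = []"
| "collapse (x # xs) = (if x = 0 then collapse xs else if 0 < x then (nat x - 1) # collapse xs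
      else collapse xs @ [nat (- x) - 1])"

text \<open>The share of \<open>stat\<close> that the signs alone decide: comparisons with a zero
  letter, and the later letters paid for by a negative one.\<close>

fun sign_stat :: "int list \<Rightarrow> nat" where
  "sign_stat [] = 0"
| "sign_stat (x # xs) = (if x = 0 then length (filter (\<lambda>y. y \<noteq> 0) xs) else if 0 < x then 0
      else length xs + length (filter (\<lambda>y. y = 0) xs)) + sign_stat xs"

definition abs_sum :: "int list \<Rightarrow> nat" where
  "abs_sum xs = sum_list (map (\<lambda>x. nat \<bar>x\<bar>) xs)"

lemma noninv_snoc: "noninv (xs @ [z]) = noninv xs + length (filter (\<lambda>y. y < z) xs)"
  by (induction xs) auto

lemma length_filter_collapse:
  "length (filter P (collapse xs)) = length (filter (\<lambda>y. y \<noteq> 0 \<and> P (nat \<bar>y\<bar> - 1)) xs)"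
  by (induction xs) auto

lemma length_collapse: "length (collapse xs) = length (filter (\<lambda>y. y \<noteq> 0) xs)"
  using length_filter_collapse[of "\<lambda>_. True" xs] by simp

text \<open>\<open>collapse\<close> moves a negative letter behind all later ones, so the later
  letters of smaller absolute value precede it there and are counted by \<open>noninv\<close> as
  well. Comparisons that involve a zero go to \<open>sign_stat\<close>.\<close>

lemma stat_eq: "stat xs = sign_stat xs + noninv (collapse xs)"
proof (induction xs)
  case (Cons x xs)
  consider "x = 0" | "x > 0" | "x < 0" by linarith
  then show ?case
  proof cases
    case 1
    then show ?thesis using Cons by simp
  next
    case 2
    have "filter (\<lambda>y. y \<noteq> 0 \<and> nat x - 1 < nat \<bar>y\<bar> - 1) xs = filter (\<lambda>y. x < \<bar>y\<bar>) xs"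
      using 2 by (intro filter_cong) auto
    then show ?thesis using 2 Cons by (simp add: length_filter_collapse)
  next
    case 3
    have "filter (\<lambda>y. y \<noteq> 0 \<and> nat \<bar>y\<bar> - 1 < nat (- x) - 1) xs = filter (\<lambda>y. y \<noteq> 0 \<and> \<bar>y\<bar> < \<bar>x\<bar>) xs"
      using 3 by (intro filter_cong) auto
    moreover have "length (filter (\<lambda>y. y \<noteq> 0 \<and> \<bar>y\<bar> < \<bar>x\<bar>) xs) + length (filter (\<lambda>y. y = 0) xs)
        = length (filter (\<lambda>y. \<bar>y\<bar> < \<bar>x\<bar>) xs)"
      using 3 by (induction xs) auto
    ultimately have "length (filter (\<lambda>y. y \<noteq> 0 \<and> nat \<bar>y\<bar> - 1 < nat (- x) - 1) xs) + length (filter (\<lambda>y. y = 0) xs)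
        = length (filter (\<lambda>y. \<bar>y\<bar> < \<bar>x\<bar>) xs)" by simp
    then show ?thesis using 3 Cons by (simp add: length_filter_collapse noninv_snoc)
  qed
qed simp

lemma abs_sum_eq: "abs_sum xs = length (filter (\<lambda>y. y \<noteq> 0) xs) + sum_list (collapse xs)"
  by (induction xs) (auto simp: abs_sum_def)

lemma filter_map_sgn:
  "length (filter (\<lambda>y. y \<noteq> 0) (map sgn xs)) = length (filter (\<lambda>y. y \<noteq> (0::int)) xs)"
  "length (filter (\<lambda>y. y = 0) (map sgn xs)) = length (filter (\<lambda>y. y = (0::int)) xs)"
  by (induction xs) (auto simp: sgn_if)

lemma sign_stat_map_sgn: "sign_stat (map sgn xs) = sign_stat xs"
  by (induction xs) (use filter_map_sgn in \<open>auto simp del: length_filter_map\<close>)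

text \<open>The sign of a letter tells at which end of the collapsed word its value sits, so letters
  can be peeled off one at a time. Read backwards, this gives \<open>collapse_surj\<close>.\<close>

lemma collapse_inj:
  "map sgn xs = map sgn ys \<Longrightarrow> collapse xs = collapse ys \<Longrightarrow> xs = ys"
proof (induction xs arbitrary: ys)
  case (Cons x xs)
  then obtain y ys' where ys: "ys = y # ys'" "sgn x = sgn y" "map sgn xs = map sgn ys'"
    by (cases ys) auto
  have "collapse xs = collapse ys' \<and> x = y"
    using Cons.prems(2) ys(1,2) by (auto simp: sgn_if split: if_splits)
  then show ?case using Cons.IH ys by simp
qed simp

lemma collapse_surj:
  assumes "set s \<subseteq> {-1, 0, 1}" "length w = length (filter (\<lambda>y. y \<noteq> 0) s)"
  shows "\<exists>xs. map sgn xs = s \<and> collapse xs = w"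
  using assms
proof (induction s arbitrary: w)
  case (Cons e s)
  consider "e = 0" | "e = 1" | "e = -1" using Cons.prems(1) by auto
  then show ?case
  proof cases
    case 1
    then obtain xs where "map sgn xs = s" "collapse xs = w" using Cons by force
    then show ?thesis using 1 by (intro exI[of _ "0 # xs"]) simp
  next
    case 2
    then obtain a w' where w: "w = a # w'" using Cons.prems(2) by (cases w) auto
    then obtain xs where "map sgn xs = s" "collapse xs = w'" using Cons 2 by force
    then show ?thesis using 2 w by (intro exI[of _ "(int a + 1) # xs"]) (simp add: nat_add_distrib)
  next
    case 3
    then obtain a w' where w: "w = w' @ [a]" using Cons.prems(2) by (cases w rule: rev_cases) auto
    then obtain xs where "map sgn xs = s" "collapse xs = w'" using Cons 3 by force
    then show ?thesis using 3 w by (intro exI[of _ "(- int a - 1) # xs"]) (simp add: nat_add_distrib)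
  qed
qed simp

lemma finite_fibres_int_lists: "finite_fibres {c :: int list. length c = k} abs_sum"
  unfolding finite_fibres_def
proof
  fix n
  have "{c\<in>{c. length c = k}. abs_sum c = n} \<subseteq> {c. set c \<subseteq> {- int n..int n} \<and> length c = k}"
  proof clarsimp
    fix c :: "int list" and x assume "x \<in> set c"
    then have "nat \<bar>x\<bar> \<le> abs_sum c" unfolding abs_sum_def by (intro member_le_sum_list) auto
    then show "- int (abs_sum c) \<le> x \<and> x \<le> int (abs_sum c)" by linarith
  qed
  then show "finite {c\<in>{c. length c = k}. abs_sum c = n}"
    by (rule finite_subset) (simp add: finite_lists_length_eq)
qed

section \<open>Generating functions of words with prescribed signs\<close>

definition word_gf :: "rat \<Rightarrow> nat \<Rightarrow> rat fps" where
  "word_gf q k = gf {w. length w = k} sum_list (\<lambda>w. q ^ noninv w)"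

definition signs :: "nat \<Rightarrow> nat \<Rightarrow> nat \<Rightarrow> int list set" where
  "signs z p m = {s. set s \<subseteq> {-1, 0, 1} \<and> count_list s 0 = z \<and> count_list s 1 = p \<and> count_list s (-1) = m}"

lemma length_signs: "set s \<subseteq> {-1, 0, 1} \<Longrightarrow>
    length s = count_list s 0 + count_list s 1 + count_list s (- 1 :: int)"
  by (induction s) auto

lemma length_filter_signs:
  assumes "set s \<subseteq> {-1, 0, 1 :: int}"
  shows "length (filter (\<lambda>y. y \<noteq> 0) s) = count_list s 1 + count_list s (-1)"
    "length (filter (\<lambda>y. y = 0) s) = count_list s 0"
  using assms by (induction s) auto

lemma finite_signs: "finite (signs z p m)"
proof (rule finite_subset)
  show "signs z p m \<subseteq> {s. set s \<subseteq> {-1, 0, 1} \<and> length s = z + p + m}"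
    unfolding signs_def using length_signs by auto
qed (simp add: finite_lists_length_eq)

definition signs_gf :: "rat \<Rightarrow> nat \<Rightarrow> nat \<Rightarrow> nat \<Rightarrow> rat" where
  "signs_gf q z p m = (\<Sum>s\<in>signs z p m. q ^ sign_stat s)"

lemma fps_const_sum: "fps_const (\<Sum>x\<in>A. f x) = (\<Sum>x\<in>A. fps_const (f x))"
  by (induction A rule: infinite_finite_induct) (auto simp flip: fps_const_add)

text \<open>With the signs fixed, \<open>collapse\<close> is a bijection onto all words of natural
  numbers of length p + m; t^(p + m) records the unit taken from each nonzero letter.\<close>

lemma gf_fixed_signs:
  assumes "s \<in> signs z p m"
  shows "gf {c. map sgn c = s} abs_sum (\<lambda>c. q ^ stat c)
    = fps_const (q ^ sign_stat s) * fps_X ^ (p + m) * word_gf q (p + m)"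
proof -
  have s: "set s \<subseteq> {-1, 0, 1}" using assms by (auto simp: signs_def)
  have nz: "length (filter (\<lambda>y. y \<noteq> 0) s) = p + m"
    using assms length_filter_signs(1)[OF s] by (auto simp: signs_def)
  have len: "length (filter (\<lambda>y. y \<noteq> 0) c) = p + m" if "map sgn c = s" for c
    using nz filter_map_sgn(1)[of c] that by simp
  have "gf {c. map sgn c = s} abs_sum (\<lambda>c. q ^ stat c)
      = gf {w. length w = p + m} (\<lambda>w. (p + m) + sum_list w) (\<lambda>w. q ^ sign_stat s * q ^ noninv w)"
  proof (rule gf_bij_betw)
    show "bij_betw collapse {c. map sgn c = s} {w. length w = p + m}"
      unfolding bij_betw_def
    proof
      show "inj_on collapse {c. map sgn c = s}"
        using collapse_inj by (intro inj_onI) simp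
      show "collapse ` {c. map sgn c = s} = {w. length w = p + m}"
      proof safe
        fix w :: "nat list" assume "length w = p + m"
        then obtain c where "map sgn c = s" "collapse c = w"
          using collapse_surj[OF s, of w] nz by metis
        then show "w \<in> collapse ` {c. map sgn c = s}" by blast
      qed (use len in \<open>auto simp: length_collapse\<close>)
    qed
  next
    fix c assume "c \<in> {c. map sgn c = s}"
    then have c: "map sgn c = s" by simp
    show "p + m + sum_list (collapse c) = abs_sum c" using len[OF c] by (simp add: abs_sum_eq)
    show "q ^ sign_stat s * q ^ noninv (collapse c) = q ^ stat c"
      using sign_stat_map_sgn[of c] c by (simp add: stat_eq power_add)
  qed
  then show ?thesis by (simp only: gf_scale_shift word_gf_def)
qed

lemma map_sgn_signs:
  "map sgn c \<in> signs (count_list (map sgn c) 0) (count_list (map sgn c) 1) (count_list (map sgn c) (-1))"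
  for c :: "int list"
  by (auto simp: signs_def sgn_if)

text \<open>The predicate \<open>P\<close> stays free because the expansion is used twice: with m =
  0 for words of natural numbers, and with m even for the final identity.\<close>

lemma gf_int_lists:
  "gf {c. length c = d \<and> P (count_list (map sgn c) (-1))} abs_sum (\<lambda>c. q ^ stat c)
    = (\<Sum>(p, m)\<in>{(p, m). p + m \<le> d \<and> P m}.
        fps_const (signs_gf q (d - (p + m)) p m) * fps_X ^ (p + m) * word_gf q (p + m))"
proof -
  let ?C = "{c :: int list. length c = d \<and> P (count_list (map sgn c) (-1))}"
  let ?K = "{(p, m). p + m \<le> d \<and> P m}"
  have fin: "finite_fibres A abs_sum" if "A \<subseteq> ?C" for A
    using finite_fibres_int_lists[of d] by (rule finite_fibres_subset) (use that in auto)
  have finK: "finite ?K" by (rule finite_subset[of _ "{..d} \<times> {..d}"]) auto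
  have eq: "count_list (map sgn c) 0 + count_list (map sgn c) 1 + count_list (map sgn c) (-1) = length c" for c :: "int list"
    using length_signs[of "map sgn c"] map_sgn_signs[of c] by (simp add: signs_def)
  let ?g = "\<lambda>c :: int list. (count_list (map sgn c) 1, count_list (map sgn c) (-1))"
  have "gf ?C abs_sum (\<lambda>c. q ^ stat c) = (\<Sum>k\<in>?K. gf {c\<in>?C. ?g c = k} abs_sum (\<lambda>c. q ^ stat c))"
  proof (rule gf_partition[OF fin finK])
    show "?g ` ?C \<subseteq> ?K"
    proof (rule image_subsetI)
      fix c :: "int list" assume "c \<in> ?C"
      then show "?g c \<in> ?K" using eq[of c] by auto
    qed
  qed simp
  also have "\<dots> = (\<Sum>(p, m)\<in>?K. fps_const (signs_gf q (d - (p + m)) p m) * fps_X ^ (p + m) * word_gf q (p + m))"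
  proof (rule sum.cong[OF refl], clarify)
    fix p m assume pm: "p + m \<le> d" "P m"
    let ?A = "{c\<in>?C. ?g c = (p, m)}"
    have "map sgn c \<in> signs (d - (p + m)) p m" if "c \<in> ?A" for c
      using map_sgn_signs[of c] that eq[of c] by (auto simp: add.assoc)
    then have sub: "map sgn ` ?A \<subseteq> signs (d - (p + m)) p m" by auto
    have "gf ?A abs_sum (\<lambda>c. q ^ stat c)
        = (\<Sum>s\<in>signs (d - (p + m)) p m. gf {c\<in>?A. map sgn c = s} abs_sum (\<lambda>c. q ^ stat c))"
      by (rule gf_partition[OF fin finite_signs sub]) auto
    also have "\<dots> = (\<Sum>s\<in>signs (d - (p + m)) p m.
        fps_const (q ^ sign_stat s) * fps_X ^ (p + m) * word_gf q (p + m))"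
    proof (rule sum.cong[OF refl])
      fix s assume s: "s \<in> signs (d - (p + m)) p m"
      then have "length s = d" "count_list s 1 = p" "count_list s (-1) = m"
        using length_signs[of s] pm unfolding signs_def by auto
      then have "{c\<in>?A. map sgn c = s} = {c. map sgn c = s}"
        using pm by auto
      then show "gf {c\<in>?A. map sgn c = s} abs_sum (\<lambda>c. q ^ stat c)
          = fps_const (q ^ sign_stat s) * fps_X ^ (p + m) * word_gf q (p + m)"
        using gf_fixed_signs[OF s] by simp
    qed
    also have "\<dots> = fps_const (signs_gf q (d - (p + m)) p m) * fps_X ^ (p + m) * word_gf q (p + m)"
      by (simp add: signs_gf_def sum_distrib_right fps_const_sum)
    finally show "gf ?A abs_sum (\<lambda>c. q ^ stat c)
        = fps_const (signs_gf q (d - (p + m)) p m) * fps_X ^ (p + m) * word_gf q (p + m)" .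
  qed
  finally show ?thesis .
qed

lemma stat_map_int: "stat (map int w) = noninv w"
  by (induction w) (auto simp: filter_map o_def)

text \<open>Words of natural numbers are the integer words without minus signs. The term j = k
  contains the left-hand side again, multiplied by t^k, so for k > 0 the smaller lengths determine
  \<open>word_gf q k\<close>.\<close>

lemma word_gf_recursion:
  "word_gf q k = (\<Sum>j\<le>k. fps_const (signs_gf q (k - j) j 0) * fps_X ^ j * word_gf q j)"
proof -
  have "word_gf q k = gf {c. length c = k \<and> count_list (map sgn c) (-1) = 0} abs_sum (\<lambda>c. q ^ stat c)"
    unfolding word_gf_def
  proof (rule gf_bij_betw)
    show "bij_betw (map int) {w. length w = k} {c. length c = k \<and> count_list (map sgn c) (-1) = 0}"
      unfolding bij_betw_def
    proof (intro conjI equalityI subsetI)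
      show "inj_on (map int) {w. length w = k}" by (rule inj_on_subset[of _ UNIV]) (simp_all add: inj_mapI)
      fix c :: "int list" assume "c \<in> {c. length c = k \<and> count_list (map sgn c) (-1) = 0}"
      then have c: "length c = k" "-1 \<notin> set (map sgn c)" by (simp_all add: count_list_0_iff)
      have "x \<ge> 0" if "x \<in> set c" for x
      proof (rule ccontr)
        assume "\<not> x \<ge> 0"
        then have "sgn x = -1" by simp
        then show False using c(2) that by (metis image_eqI list.set_map)
      qed
      then have "map int (map nat c) = c" by (simp add: map_idI)
      then show "c \<in> map int ` {w. length w = k}" 
        using c(1) by (intro image_eqI[of _ _ "map nat c"]) auto
    qed (auto simp: count_list_0_iff sgn_if)
    show "abs_sum (map int w) = sum_list w" for w
      by (simp add: abs_sum_def o_def)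
  qed (simp add: stat_map_int)
  also have "\<dots> = (\<Sum>(p, m)\<in>{(p, m). p + m \<le> k \<and> m = 0}.
        fps_const (signs_gf q (k - (p + m)) p m) * fps_X ^ (p + m) * word_gf q (p + m))"
    using gf_int_lists[of k "\<lambda>m. m = 0" q] by simp
  also have "\<dots> = (\<Sum>j\<le>k. fps_const (signs_gf q (k - j) j 0) * fps_X ^ j * word_gf q j)"
    by (rule sum.reindex_bij_witness[of _ "\<lambda>j. (j, 0)" fst]) auto
  finally show ?thesis .
qed

section \<open>The q-multinomial formula for sign patterns\<close>

text \<open>This is (q - 1)^n [n]!; the powers of q - 1 cancel in the quotients that occur.\<close>

definition qfact :: "rat \<Rightarrow> nat \<Rightarrow> rat" where
  "qfact q n = (\<Prod>i=1..n. q ^ i - 1)"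

lemma qfact_simps [simp]: "qfact q 0 = 1" "qfact q (Suc n) = qfact q n * (q ^ Suc n - 1)"
  by (simp_all add: qfact_def)

text \<open>Remove the first sign: a zero pays for the p + m nonzero signs after it, a plus pays
  nothing, a minus pays for all n later signs and once more for each of the z zeros.\<close>

lemma signs_gf_Cons:
  assumes "z + p + m = Suc n"
  shows "signs_gf q z p m = (if z = 0 then 0 else q ^ (p + m) * signs_gf q (z - 1) p m)
    + (if p = 0 then 0 else signs_gf q z (p - 1) m)
    + (if m = 0 then 0 else q ^ (n + z) * signs_gf q z p (m - 1))"
proof -
  let ?Z = "if z = 0 then {} else (#) 0 ` signs (z - 1) p m"
  let ?P = "if p = 0 then {} else (#) 1 ` signs z (p - 1) m"
  let ?M = "if m = 0 then {} else (#) (-1) ` signs z p (m - 1)"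
  have "signs z p m = ?Z \<union> ?P \<union> ?M"
  proof (intro equalityI subsetI)
    fix s assume s: "s \<in> signs z p m"
    then obtain e t where "s = e # t" using assms by (cases s) (auto simp: signs_def)
    with s show "s \<in> ?Z \<union> ?P \<union> ?M" by (auto simp: signs_def split: if_splits)
  qed (auto simp: signs_def split: if_splits)
  moreover have "finite ?Z" "finite ?P" "finite ?M" "?Z \<inter> ?P = {}" "(?Z \<union> ?P) \<inter> ?M = {}"
    by (auto simp: finite_signs)
  ultimately have *: "signs_gf q z p m = (\<Sum>s\<in>?Z. q ^ sign_stat s) + (\<Sum>s\<in>?P. q ^ sign_stat s) + (\<Sum>s\<in>?M. q ^ sign_stat s)"
    unfolding signs_gf_def by (simp only: sum.union_disjoint finite_UnI)
  have Z: "(\<Sum>s\<in>?Z. q ^ sign_stat s) = q ^ (p + m) * signs_gf q (z - 1) p m" if "z \<noteq> 0"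
  proof -
    have "sign_stat (0 # s) = p + m + sign_stat s" if "s \<in> signs (z - 1) p m" for s
      using that by (auto simp: signs_def length_filter_signs)
    then show ?thesis using that
      by (simp add: sum.reindex signs_gf_def sum_distrib_left power_add)
  qed
  have P: "(\<Sum>s\<in>?P. q ^ sign_stat s) = signs_gf q z (p - 1) m" if "p \<noteq> 0"
    using that by (simp add: sum.reindex signs_gf_def)
  have M: "(\<Sum>s\<in>?M. q ^ sign_stat s) = q ^ (n + z) * signs_gf q z p (m - 1)" if "m \<noteq> 0"
  proof -
    have "sign_stat (-1 # s) = n + z + sign_stat s" if "s \<in> signs z p (m - 1)" for s
      using that \<open>m \<noteq> 0\<close> assms length_signs[of s] by (auto simp: signs_def length_filter_signs)
    then show ?thesis using that
      by (simp add: sum.reindex signs_gf_def sum_distrib_left power_add)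
  qed
  show ?thesis unfolding * using Z P M by (cases "z = 0"; cases "p = 0"; cases "m = 0") simp_all
qed

text \<open>In the induction on the first sign, the three cases leave q^p (q^z - 1), q^p - 1 and
  q^(z + p) (q^m - 1), whose sum telescopes to q^(z + p + m) - 1.\<close>

lemma signs_gf_qfact:
  "signs_gf q z p m * (qfact q z * qfact q p * qfact q m)
    = qfact q (z + p + m) * q ^ ((m choose 2) + m * z)"
proof (induction "z + p + m" arbitrary: z p m)
  case 0
  then have "signs z p m = {[]}" using length_signs by (fastforce simp: signs_def)
  then show ?case using 0 by (simp add: signs_gf_def numeral_2_eq_2)
next
  case (Suc n)
  let ?e = "(m choose 2) + m * z"
  have Z: "(if z = 0 then 0 else q ^ (p + m) * signs_gf q (z - 1) p m) * (qfact q z * qfact q p * qfact q m)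
      = qfact q n * q ^ ?e * (q ^ p * (q ^ z - 1))"
  proof (cases z)
    case (Suc z')
    then have "signs_gf q z' p m * (qfact q z' * qfact q p * qfact q m) = qfact q n * q ^ ((m choose 2) + m * z')"
      using Suc.hyps by (metis add_Suc nat.inject)
    then have "q ^ (p + m) * (signs_gf q z' p m * (qfact q z' * qfact q p * qfact q m)) * (q ^ z - 1)
        = q ^ (p + m) * (qfact q n * q ^ ((m choose 2) + m * z')) * (q ^ z - 1)" by simp
    then show ?thesis using Suc by (simp add: power_add mult_ac)
  qed simp
  have P: "(if p = 0 then 0 else signs_gf q z (p - 1) m) * (qfact q z * qfact q p * qfact q m)
      = qfact q n * q ^ ?e * (q ^ p - 1)"
  proof (cases p)
    case (Suc p')
    then have "signs_gf q z p' m * (qfact q z * qfact q p' * qfact q m) = qfact q n * q ^ ?e"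
      using Suc.hyps by (metis add_Suc add_Suc_right nat.inject)
    then have "signs_gf q z p' m * (qfact q z * qfact q p' * qfact q m) * (q ^ p - 1)
        = qfact q n * q ^ ?e * (q ^ p - 1)" by simp
    then show ?thesis using Suc by (simp add: mult_ac)
  qed simp
  have M: "(if m = 0 then 0 else q ^ (n + z) * signs_gf q z p (m - 1)) * (qfact q z * qfact q p * qfact q m)
      = qfact q n * q ^ ?e * (q ^ (z + p) * (q ^ m - 1))"
  proof (cases m)
    case (Suc m')
    then have IH: "signs_gf q z p m' * (qfact q z * qfact q p * qfact q m') = qfact q n * q ^ ((m' choose 2) + m' * z)"
      using Suc.hyps by (metis add_Suc_right nat.inject)
    \<comment> \<open>The m' later minus signs turn (m' choose 2) into (m choose 2); the zeros, paid
      for twice, supply one z for m z and one for the factor q^(z + p).\<close>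
    have "q ^ (n + z) * q ^ ((m' choose 2) + m' * z) = q ^ ?e * q ^ (z + p)"
    proof -
      have "n = z + p + m'" using Suc.hyps(2) Suc by simp
      then have "n + z + ((m' choose 2) + m' * z) = ?e + (z + p)"
        using Suc by (simp add: numeral_2_eq_2)
      then show ?thesis by (simp only: power_add[symmetric])
    qed
    then have "q ^ (n + z) * (signs_gf q z p m' * (qfact q z * qfact q p * qfact q m')) * (q ^ m - 1)
        = qfact q n * q ^ ?e * (q ^ (z + p) * (q ^ m - 1))" unfolding IH by simp
    then show ?thesis using Suc by (simp add: mult_ac)
  qed simp
  have "signs_gf q z p m * (qfact q z * qfact q p * qfact q m)
     = qfact q n * q ^ ?e * (q ^ p * (q ^ z - 1)) + qfact q n * q ^ ?e * (q ^ p - 1)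
       + qfact q n * q ^ ?e * (q ^ (z + p) * (q ^ m - 1))"
    unfolding signs_gf_Cons[OF Suc.hyps(2)[symmetric]] distrib_right Z P M ..
  also have "\<dots> = qfact q n * q ^ ?e * (q ^ (z + p + m) - 1)"
    by (simp add: power_add algebra_simps)
  also have "\<dots> = qfact q (z + p + m) * q ^ ?e"
    unfolding Suc.hyps(2)[symmetric] by simp
  finally show ?case .
qed

section \<open>Signed permutations and integer words\<close>

text \<open>\<open>e i\<close> is the drop forced after position i. The value 0 outside {1..d} turns
  the condition at i = d into e d \<le> a d.\<close>

definition desc_seqs :: "(nat \<Rightarrow> nat) \<Rightarrow> nat \<Rightarrow> (nat \<Rightarrow> nat) set" where
  "desc_seqs e d = {a. (\<forall>i. i \<notin> {1..d} \<longrightarrow> a i = 0) \<and> (\<forall>i\<in>{1..d}. a (Suc i) + e i \<le> a i)}"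

lemma desc_seqs_last_le:
  assumes "a \<in> desc_seqs e (Suc d)" "1 \<le> i" "i \<le> Suc d"
  shows "a (Suc d) \<le> a i"
  using assms(3,2)
proof (induction rule: inc_induct)
  case (step n)
  then have "a (Suc n) + e n \<le> a n" using assms(1) by (auto simp: desc_seqs_def)
  then show ?case using step by simp
qed simp

text \<open>Subtract the last entry from all others: it is \<open>e (Suc d)\<close> plus a free k,
  and what remains is a sequence of length d.\<close>

lemma bij_betw_desc_seqs_Suc:
  "bij_betw (\<lambda>(a, k) i. if i \<in> {1..Suc d} then a i + (k + e (Suc d)) else 0)
    (desc_seqs e d \<times> UNIV) (desc_seqs e (Suc d))"
proof (rule bij_betw_byWitness[where
      f' = "\<lambda>a. (\<lambda>i. if i \<in> {1..d} then a i - a (Suc d) else 0, a (Suc d) - e (Suc d))"])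
  let ?f = "\<lambda>(a, k) i. if i \<in> {1..Suc d} then a i + (k + e (Suc d)) else 0"
  let ?g = "\<lambda>a. (\<lambda>i. if i \<in> {1..d} then a i - a (Suc d) else 0, a (Suc d) - e (Suc d))"
  show "\<forall>p\<in>desc_seqs e d \<times> UNIV. ?g (?f p) = p"
    by (auto simp: desc_seqs_def fun_eq_iff)
  show "\<forall>a\<in>desc_seqs e (Suc d). ?f (?g a) = a"
  proof
    fix a assume a: "a \<in> desc_seqs e (Suc d)"
    have "e (Suc d) \<le> a (Suc d)" using a by (force simp: desc_seqs_def)
    moreover have "a i = 0" if "i \<notin> {1..Suc d}" for i using a that by (auto simp: desc_seqs_def)
    ultimately show "?f (?g a) = a"
      using desc_seqs_last_le[OF a] by (auto simp: fun_eq_iff le_Suc_eq)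
  qed
  show "?f ` (desc_seqs e d \<times> UNIV) \<subseteq> desc_seqs e (Suc d)"
  proof clarify
    fix a k assume a: "a \<in> desc_seqs e d"
    have "a (Suc d) = 0" "a (Suc (Suc d)) = 0" using a by (auto simp: desc_seqs_def)
    moreover have "a (Suc i) + e i \<le> a i" if "1 \<le> i" "i \<le> d" for i
      using a that by (auto simp: desc_seqs_def)
    moreover from calculation have "1 \<le> d \<Longrightarrow> e d \<le> a d" by force
    ultimately show "(\<lambda>i. if i \<in> {1..Suc d} then a i + (k + e (Suc d)) else 0) \<in> desc_seqs e (Suc d)"
      by (auto simp: desc_seqs_def le_Suc_eq)
  qed
  show "?g ` desc_seqs e (Suc d) \<subseteq> desc_seqs e d \<times> UNIV"
  proof clarify
    fix a assume a: "a \<in> desc_seqs e (Suc d)"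
    have "a (Suc i) + e i \<le> a i" if "1 \<le> i" "i \<le> Suc d" for i
      using a that by (auto simp: desc_seqs_def)
    moreover have "a (Suc d) \<le> a i" if "1 \<le> i" "i \<le> Suc d" for i
      using desc_seqs_last_le[OF a] that by auto
    ultimately have "(if Suc i \<in> {1..d} then a (Suc i) - a (Suc d) else 0) + e i
        \<le> (if i \<in> {1..d} then a i - a (Suc d) else 0)" if "i \<in> {1..d}" for i
      using that by (cases "i = d") (force simp: diff_add_assoc2[symmetric])+
    then show "(\<lambda>i. if i \<in> {1..d} then a i - a (Suc d) else 0) \<in> desc_seqs e d \<and> a (Suc d) - e (Suc d) \<in> UNIV"
      by (auto simp: desc_seqs_def)
  qed
qed

text \<open>Adding k + e (Suc d) to all Suc d entries costs Suc d times that amount, which yields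
  one geometric factor per step. Finiteness is part of the induction because \<open>gf_Times\<close>
  asks for it.\<close>

lemma gf_desc_seqs:
  "finite_fibres (desc_seqs e d) (\<lambda>a. \<Sum>i=1..d. a i) \<and>
   gf (desc_seqs e d) (\<lambda>a. \<Sum>i=1..d. a i) (\<lambda>_. 1)
     = fps_X ^ (\<Sum>i=1..d. i * e i) * (\<Prod>j=1..d. 1 / (1 - fps_X ^ j))"
proof (induction d)
  case 0
  have "desc_seqs e 0 = {\<lambda>_. 0}" by (auto simp: desc_seqs_def)
  then show ?case by (simp add: gf_singleton finite_fibres_def)
next
  case (Suc d)
  let ?f = "\<lambda>(a, k) i. if i \<in> {1..Suc d} then a i + (k + e (Suc d)) else (0 :: nat)"
  let ?w = "\<lambda>(a, k). (\<Sum>i=1..d. a i) + (Suc d * e (Suc d) + Suc d * k)"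
  have w: "(\<Sum>i=1..Suc d. ?f p i) = ?w p" if "p \<in> desc_seqs e d \<times> UNIV" for p
  proof -
    obtain a k where p: "p = (a, k)" by (cases p)
    have "a (Suc d) = 0" using that p by (auto simp: desc_seqs_def)
    moreover have "(\<Sum>i=1..d. if i \<in> {1..Suc d} then a i + (k + e (Suc d)) else 0)
        = (\<Sum>i=1..d. a i + (k + e (Suc d)))" by (intro sum.cong) auto
    ultimately show ?thesis using p by (simp add: sum.distrib algebra_simps)
  qed
  have fin: "finite_fibres (desc_seqs e d \<times> UNIV) ?w"
    using Suc finite_fibres_add[OF finite_fibres_mult[of "Suc d"]] by (intro finite_fibres_Times) auto
  have fin': "finite_fibres (desc_seqs e (Suc d)) (\<lambda>a. \<Sum>i=1..Suc d. a i)"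
    using bij_betw_imp_surj_on[OF bij_betw_desc_seqs_Suc[of d e]] w
    by (intro finite_fibres_image[OF fin, of _ ?f]) auto
  have "gf (desc_seqs e (Suc d)) (\<lambda>a. \<Sum>i=1..Suc d. a i) (\<lambda>_. 1)
      = gf (desc_seqs e d \<times> UNIV) ?w (\<lambda>(x, y). 1 * 1)"
    by (rule gf_bij_betw[OF bij_betw_desc_seqs_Suc, symmetric]) (use w in auto)
  moreover have "\<dots> = gf (desc_seqs e d) (\<lambda>a. \<Sum>i=1..d. a i) (\<lambda>_. 1)
      * gf UNIV (\<lambda>k. Suc d * e (Suc d) + Suc d * k) (\<lambda>_. 1)"
    using Suc finite_fibres_add[OF finite_fibres_mult[of "Suc d"]] by (intro gf_Times) auto
  moreover have "gf UNIV (\<lambda>k. Suc d * e (Suc d) + Suc d * k) (\<lambda>_. 1)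
      = fps_X ^ (Suc d * e (Suc d)) * (1 / (1 - fps_X ^ Suc d))"
    by (simp only: gf_shift gf_geometric zero_less_Suc)
  ultimately have "gf (desc_seqs e (Suc d)) (\<lambda>a. \<Sum>i=1..Suc d. a i) (\<lambda>_. 1)
      = fps_X ^ (\<Sum>i=1..d. i * e i) * (\<Prod>j=1..d. 1 / (1 - fps_X ^ j))
        * (fps_X ^ (Suc d * e (Suc d)) * (1 / (1 - fps_X ^ Suc d)))"
    using Suc by simp
  then have "gf (desc_seqs e (Suc d)) (\<lambda>a. \<Sum>i=1..Suc d. a i) (\<lambda>_. 1)
      = fps_X ^ (\<Sum>i=1..Suc d. i * e i) * (\<Prod>j=1..Suc d. 1 / (1 - fps_X ^ j))"
    by (simp add: power_add mult_ac)
  with fin' show ?case by blast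
qed

section \<open>Signed permutations and the sorting bijection\<close>

definition signed_range :: "nat \<Rightarrow> int set" where
  "signed_range d = {- int d..int d} - {0}"

definition signed_perms :: "nat \<Rightarrow> (int \<Rightarrow> int) set" where
  "signed_perms d = {\<sigma>. \<sigma> permutes signed_range d \<and> (\<forall>i\<in>signed_range d. \<sigma> (- i) = - \<sigma> i)}"

lemma signed_perm_minus:
  assumes "\<sigma> \<in> signed_perms d"
  shows "\<sigma> (- i) = - \<sigma> i"
proof (cases "i \<in> signed_range d")
  case False
  then have "\<sigma> i = i" "\<sigma> (- i) = - i"
    using assms permutes_not_in[of \<sigma> "signed_range d"]
    by (auto simp: signed_perms_def signed_range_def)
  then show ?thesis by simp
qed (use assms in \<open>auto simp: signed_perms_def\<close>)

lemma signed_perm_inv_minus: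
  assumes "\<sigma> \<in> signed_perms d"
  shows "inv \<sigma> (- i) = - inv \<sigma> i"
proof -
  have "bij \<sigma>" using assms permutes_bij by (auto simp: signed_perms_def)
  then show ?thesis
    using signed_perm_minus[OF assms, of "inv \<sigma> i"] by (metis bij_inv_eq_iff)
qed

lemma signed_perm_in:
  assumes "\<sigma> \<in> signed_perms d"
  shows "\<sigma> i \<in> signed_range d \<longleftrightarrow> i \<in> signed_range d" "inv \<sigma> i \<in> signed_range d \<longleftrightarrow> i \<in> signed_range d"
  using assms permutes_in_image[of \<sigma>] permutes_in_image[OF permutes_inv, of \<sigma>]
  by (simp_all add: signed_perms_def)

lemma signed_perm_inv [simp]:
  assumes "\<sigma> \<in> signed_perms d"
  shows "\<sigma> (inv \<sigma> i) = i" "inv \<sigma> (\<sigma> i) = i"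
  using assms permutes_inverses[of \<sigma> "signed_range d"] by (simp_all add: signed_perms_def)

text \<open>A word \<open>c\<close> on the labels \<open>1,\<dots>,d\<close> is extended to signed labels so that \<open>c + 1/2\<close> becomes odd;
  exactly one of \<open>x\<close> and \<open>- x\<close> then has a nonnegative entry.\<close>

definition entry :: "int list \<Rightarrow> int \<Rightarrow> int" where
  "entry c x = (if 0 < x then c ! (nat x - 1) else - 1 - c ! (nat (- x) - 1))"

lemma entry_minus: "x \<noteq> 0 \<Longrightarrow> entry c (- x) = - 1 - entry c x"
  by (auto simp: entry_def)

text \<open>One integer for the lexicographic order that puts larger entries first and then smaller
  labels; 2 d + 1 exceeds every difference of two labels.\<close>

definition key :: "nat \<Rightarrow> int list \<Rightarrow> int \<Rightarrow> int" where
  "key d c x = x - (2 * int d + 1) * entry c x"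

lemma key_less_iff:
  assumes "x \<in> signed_range d" "y \<in> signed_range d"
  shows "key d c x < key d c y \<longleftrightarrow> entry c y < entry c x \<or> entry c x = entry c y \<and> x < y"
proof -
  have b: "\<bar>x - y\<bar> < 2 * int d + 1" using assms by (auto simp: signed_range_def)
  have lt: "key d c u < key d c v" if "\<bar>u - v\<bar> < 2 * int d + 1" "entry c v < entry c u" for u v
  proof -
    have "(2 * int d + 1) * (entry c v + 1) \<le> (2 * int d + 1) * entry c u"
      using that(2) by (intro mult_left_mono) auto
    then show ?thesis using that(1) unfolding key_def by (simp add: algebra_simps)
  qed
  consider "entry c y < entry c x" | "entry c x < entry c y" | "entry c x = entry c y" by linarith
  then show ?thesis
  proof cases
    case 1
    then show ?thesis using lt[OF b] by auto
  next
    case 2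
    then have "key d c y < key d c x" using lt[of y x] b by (simp add: abs_minus_commute)
    then show ?thesis using 2 by auto
  qed (auto simp: key_def)
qed

lemma inj_on_key: "inj_on (key d c) (signed_range d)"
proof (rule inj_onI, rule ccontr)
  fix x y assume *: "x \<in> signed_range d" "y \<in> signed_range d" "key d c x = key d c y" "x \<noteq> y"
  then show False using key_less_iff[of x d y c] key_less_iff[of y d x c] by auto
qed

text \<open>It is 0 at i = d, so \<open>desc_seqs\<close> forces no drop after the last
  entry.\<close>

definition descent :: "nat \<Rightarrow> (int \<Rightarrow> int) \<Rightarrow> nat \<Rightarrow> nat" where
  "descent d \<sigma> i = (if i < d \<and> \<sigma> (int i) > \<sigma> (int i + 1) then 1 else 0)"

text \<open>Value number j goes to the label \<sigma> j. If that label is negative, the letter at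
  its absolute value is - a - 1, which \<open>entry\<close> turns back into a at the label
  itself.\<close>

definition place :: "nat \<Rightarrow> (int \<Rightarrow> int) \<Rightarrow> (nat \<Rightarrow> nat) \<Rightarrow> int list" where
  "place d \<sigma> a = map (\<lambda>u. let j = inv \<sigma> (int (Suc u)) in
     if 0 < j then int (a (nat j)) else - int (a (nat (- j))) - 1) [0..<d]"

lemma length_place [simp]: "length (place d \<sigma> a) = d"
  by (simp add: place_def)

lemma entry_place:
  assumes "\<sigma> \<in> signed_perms d" "1 \<le> j" "j \<le> int d"
  shows "entry (place d \<sigma> a) (\<sigma> j) = int (a (nat j))"
proof -
  have x: "\<sigma> j \<in> signed_range d"
    using signed_perm_in(1)[OF assms(1), of j] assms by (auto simp: signed_range_def)
  show ?thesis
  proof (cases "\<sigma> j > 0")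
    case True
    then have "int (Suc (nat (\<sigma> j) - 1)) = \<sigma> j" "nat (\<sigma> j) - 1 < d"
      using x by (auto simp: signed_range_def)
    then show ?thesis using True assms by (simp add: entry_def place_def Let_def)
  next
    case False
    then have "int (Suc (nat (- \<sigma> j) - 1)) = - \<sigma> j" "nat (- \<sigma> j) - 1 < d"
      using x by (auto simp: signed_range_def)
    then show ?thesis using False assms
      by (simp add: entry_def place_def Let_def signed_perm_inv_minus)
  qed
qed

text \<open>The labels \<sigma> 1, ..., \<sigma> d contain one of x and - x for each x in the range,
  and \<open>entry_minus\<close> supplies the other entry.\<close>

lemma place_eqI:
  assumes "\<sigma> \<in> signed_perms d" "length c = d"
    and "\<And>j. 1 \<le> j \<Longrightarrow> j \<le> int d \<Longrightarrow> entry c (\<sigma> j) = int (a (nat j))"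
  shows "place d \<sigma> a = c"
proof (rule nth_equalityI)
  fix u assume "u < length (place d \<sigma> a)"
  then have u: "u < d" by simp
  define x where "x = int (Suc u)"
  have x: "x \<in> signed_range d" "0 < x" "c ! u = entry c x" "place d \<sigma> a ! u = entry (place d \<sigma> a) x"
    using u by (auto simp: x_def signed_range_def entry_def nat_add_distrib)
  define j where "j = inv \<sigma> x"
  have j: "j \<in> signed_range d" "\<sigma> j = x"
    using x(1) signed_perm_in(2)[OF assms(1)] assms(1) by (auto simp: j_def)
  have "entry (place d \<sigma> a) x = entry c x"
  proof (cases "j > 0")
    case True
    then show ?thesis using entry_place[OF assms(1), of j a] assms(3)[of j] j by (auto simp: signed_range_def)
  next
    case False
    then have "entry (place d \<sigma> a) (\<sigma> (- j)) = entry c (\<sigma> (- j))"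
      using entry_place[OF assms(1), of "- j" a] assms(3)[of "- j"] j(1) by (auto simp: signed_range_def)
    then show ?thesis using j(2) x(2) signed_perm_minus[OF assms(1)] by (simp add: entry_minus)
  qed
  then show "place d \<sigma> a ! u = c ! u" using x by simp
qed (use assms in simp)

text \<open>Opposite labels have entries of opposite kind, so nothing outside the image qualifies.
  This image is thereby recovered from the word alone.\<close>

lemma nonneg_entries:
  assumes "\<sigma> \<in> signed_perms d"
    and "\<And>j. 1 \<le> j \<Longrightarrow> j \<le> int d \<Longrightarrow> 0 \<le> entry c (\<sigma> j)"
  shows "{x\<in>signed_range d. 0 \<le> entry c x} = \<sigma> ` {1..int d}"
proof (intro equalityI subsetI)
  fix x assume x: "x \<in> {x\<in>signed_range d. 0 \<le> entry c x}"
  define j where "j = inv \<sigma> x"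
  have j: "j \<in> signed_range d" "\<sigma> j = x"
    using x signed_perm_in(2)[OF assms(1)] assms(1) by (auto simp: j_def)
  have "\<not> j < 0"
  proof
    assume "j < 0"
    then have "0 \<le> entry c (\<sigma> (- j))" using assms(2)[of "- j"] j(1) by (auto simp: signed_range_def)
    then show False using x j(2) signed_perm_minus[OF assms(1), of j] by (auto simp: entry_minus signed_range_def)
  qed
  then show "x \<in> \<sigma> ` {1..int d}" using j by (force simp: signed_range_def)
next
  fix x assume "x \<in> \<sigma> ` {1..int d}"
  then obtain j where j: "x = \<sigma> j" "1 \<le> j" "j \<le> int d" by auto
  then have "j \<in> signed_range d" by (auto simp: signed_range_def)
  then show "x \<in> {x\<in>signed_range d. 0 \<le> entry c x}"
    using assms(2) signed_perm_in(1)[OF assms(1)] j by auto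
qed

lemma strict_mono_from_steps:
  fixes f :: "nat \<Rightarrow> int"
  assumes "\<And>i. 1 \<le> i \<Longrightarrow> i < d \<Longrightarrow> f i < f (Suc i)" "1 \<le> i" "i < j" "j \<le> d"
  shows "f i < f j"
  using assms(3,4)
proof (induction j)
  case (Suc j)
  then show ?case using assms(1)[of j] assms(2) by (cases "i = j") force+
qed simp

text \<open>Equal neighbouring values are allowed where \<sigma> ascends and forbidden at a descent;
  this is precisely how \<open>key\<close> breaks ties.\<close>

lemma desc_seqs_iff_key:
  assumes "\<sigma> \<in> signed_perms d"
    and "\<And>j. 1 \<le> j \<Longrightarrow> j \<le> int d \<Longrightarrow> entry c (\<sigma> j) = int (a (nat j))"
    and "\<And>i. i \<notin> {1..d} \<Longrightarrow> a i = 0"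
  shows "a \<in> desc_seqs (descent d \<sigma>) d
    \<longleftrightarrow> (\<forall>i. 1 \<le> i \<longrightarrow> i < d \<longrightarrow> key d c (\<sigma> (int i)) < key d c (\<sigma> (int (Suc i))))"
proof -
  have step: "a (Suc i) + descent d \<sigma> i \<le> a i \<longleftrightarrow> key d c (\<sigma> (int i)) < key d c (\<sigma> (int (Suc i)))"
    if i: "1 \<le> i" "i < d" for i
  proof -
    have r: "\<sigma> (int i) \<in> signed_range d" "\<sigma> (int (Suc i)) \<in> signed_range d"
      using i signed_perm_in(1)[OF assms(1)] by (auto simp: signed_range_def)
    have ne: "\<sigma> (int i) \<noteq> \<sigma> (int (Suc i))"
      using signed_perm_inv(2)[OF assms(1)] by (metis n_not_Suc_n of_nat_eq_iff)
    have "entry c (\<sigma> (int i)) = int (a i)" "entry c (\<sigma> (int (Suc i))) = int (a (Suc i))"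
      using assms(2)[of "int i"] assms(2)[of "int (Suc i)"] i by (auto simp: nat_add_distrib)
    then show ?thesis
      unfolding key_less_iff[OF r] using ne i by (auto simp: descent_def add.commute)
  qed
  have "a (Suc d) + descent d \<sigma> d \<le> a d" using assms(3)[of "Suc d"] by (simp add: descent_def)
  then have "(\<forall>i\<in>{1..d}. a (Suc i) + descent d \<sigma> i \<le> a i)
      \<longleftrightarrow> (\<forall>i. 1 \<le> i \<longrightarrow> i < d \<longrightarrow> a (Suc i) + descent d \<sigma> i \<le> a i)"
    by (metis atLeastAtMost_iff le_neq_implies_less less_imp_le_nat)
  then show ?thesis using step assms(3) unfolding desc_seqs_def by simp
qed

lemma key_strict_mono:
  assumes "\<sigma> \<in> signed_perms d" "a \<in> desc_seqs (descent d \<sigma>) d" "1 \<le> i" "i < j" "j \<le> d"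
  shows "key d (place d \<sigma> a) (\<sigma> (int i)) < key d (place d \<sigma> a) (\<sigma> (int j))"
proof -
  have "\<And>i. i \<notin> {1..d} \<Longrightarrow> a i = 0" using assms(2) by (auto simp: desc_seqs_def)
  then have "\<forall>i. 1 \<le> i \<longrightarrow> i < d \<longrightarrow> key d (place d \<sigma> a) (\<sigma> (int i)) < key d (place d \<sigma> a) (\<sigma> (int (Suc i)))"
    using desc_seqs_iff_key[OF assms(1) entry_place[OF assms(1), of _ a]] assms(2) by blast
  then show ?thesis
    using strict_mono_from_steps[of d "\<lambda>i. key d (place d \<sigma> a) (\<sigma> (int i))" i j] assms by auto
qed

text \<open>The keys of \<sigma> 1, ..., \<sigma> d are the increasing enumeration of a set that
  depends only on the word. So the word determines \<sigma> on {1..d}, then everywhere by oddness,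
  and finally a.\<close>

lemma inj_on_place:
  "inj_on (\<lambda>(\<sigma>, a). place d \<sigma> a) (SIGMA \<sigma>:signed_perms d. desc_seqs (descent d \<sigma>) d)"
proof (rule inj_onI, clarify)
  fix \<sigma> a \<tau> b
  assume s: "\<sigma> \<in> signed_perms d" "a \<in> desc_seqs (descent d \<sigma>) d"
    and t: "\<tau> \<in> signed_perms d" "b \<in> desc_seqs (descent d \<tau>) d"
    and eq: "place d \<sigma> a = place d \<tau> b"
  define c where "c = place d \<sigma> a"
  let ?L = "\<lambda>\<sigma>. map (\<lambda>i. key d c (\<sigma> (int i))) [1..<Suc d]"
  let ?S = "{x\<in>signed_range d. 0 \<le> entry c x}"
  have L: "sorted_wrt (<) (?L \<rho>) \<and> set (?L \<rho>) = key d c ` ?S"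
    if r: "\<rho> \<in> signed_perms d" "f \<in> desc_seqs (descent d \<rho>) d" "c = place d \<rho> f" for \<rho> f
  proof
    show "sorted_wrt (<) (?L \<rho>)"
      unfolding sorted_wrt_iff_nth_less
    proof (intro allI impI)
      fix i j assume "i < j" "j < length (?L \<rho>)"
      then show "?L \<rho> ! i < ?L \<rho> ! j"
        using key_strict_mono[OF r(1,2), of "Suc i" "Suc j"] r(3) by (simp del: upt_Suc)
    qed
    have "?S = \<rho> ` {1..int d}"
      using nonneg_entries[OF r(1)] entry_place[OF r(1)] r(3) by auto
    moreover have "{1..int d} = int ` {1..<Suc d}"
      by (simp add: atLeastLessThanSuc_atLeastAtMost image_int_atLeastAtMost)
    ultimately show "set (?L \<rho>) = key d c ` ?S" by (simp add: image_image del: upt_Suc)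
  qed
  have "?L \<sigma> = ?L \<tau>"
    using L[OF s c_def] L[OF t] eq c_def by (intro strict_sorted_equal) auto
  then have keyeq: "key d c (\<sigma> (int i)) = key d c (\<tau> (int i))" if "1 \<le> i" "i \<le> d" for i
    using that by (simp del: upt_Suc add: map_eq_conv)
  have pos: "\<sigma> x = \<tau> x" if x: "1 \<le> x" "x \<le> int d" for x
  proof -
    have "key d c (\<sigma> x) = key d c (\<tau> x)" using keyeq[of "nat x"] x by simp
    moreover have "\<sigma> x \<in> signed_range d" "\<tau> x \<in> signed_range d"
      using x signed_perm_in(1) s(1) t(1) by (auto simp: signed_range_def)
    ultimately show ?thesis using inj_on_key[of d c] by (auto dest: inj_onD)
  qed
  have "\<sigma> = \<tau>"
  proof
    fix x
    consider "1 \<le> x" "x \<le> int d" | "1 \<le> - x" "- x \<le> int d" | "x \<notin> signed_range d"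
      by (force simp: signed_range_def)
    then show "\<sigma> x = \<tau> x"
    proof cases
      case 2
      then show ?thesis using pos[of "- x"] signed_perm_minus[OF s(1), of x] signed_perm_minus[OF t(1), of x] by simp
    next
      case 3
      then show ?thesis 
        using s(1) t(1) permutes_not_in[of \<sigma> "signed_range d" x]
          permutes_not_in[of \<tau> "signed_range d" x] by (simp add: signed_perms_def)
    qed (use pos in simp)
  qed
  moreover have "a = b"
  proof
    fix i
    show "a i = b i"
    proof (cases "i \<in> {1..d}")
      case True
      then show ?thesis
        using entry_place[OF s(1), of "int i" a] entry_place[OF t(1), of "int i" b] eq \<open>\<sigma> = \<tau>\<close> by auto
    qed (use s t in \<open>auto simp: desc_seqs_def\<close>)
  qed
  ultimately show "\<sigma> = \<tau> \<and> a = b" by simp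
qed

lemma place_surj:
  assumes "length c = d"
  obtains \<sigma> a where "\<sigma> \<in> signed_perms d" "a \<in> desc_seqs (descent d \<sigma>) d" "place d \<sigma> a = c"
proof -
  let ?S = "{x\<in>signed_range d. 0 \<le> entry c x}"
  have finS: "finite ?S" by (rule finite_subset[of _ "signed_range d"]) (auto simp: signed_range_def)
  have injS: "inj_on (key d c) ?S" using inj_on_key by (rule inj_on_subset) auto
  \<comment> \<open>From each pair u, - u the label with nonnegative entry is chosen, which makes d
    labels.\<close>
  have "bij_betw (\<lambda>u. if 0 \<le> entry c u then u else - u) {1..int d} ?S"
    by (rule bij_betw_byWitness[of _ abs]) (auto simp: entry_minus signed_range_def abs_if)
  then have cardS: "card ?S = d" using bij_betw_same_card by fastforce
  define K where "K = sorted_list_of_set (key d c ` ?S)"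
  have K: "set K = key d c ` ?S" "sorted_wrt (<) K" "length K = d"
    using finS card_image[OF injS] cardS by (auto simp: K_def)
  \<comment> \<open>The label with the i-th smallest key; positions start at 1, list indices at
    0.\<close>
  define f where "f i = the_inv_into ?S (key d c) (K ! (nat i - 1))" for i
  have f: "f i \<in> ?S" "key d c (f i) = K ! (nat i - 1)" if "1 \<le> i" "i \<le> int d" for i
  proof -
    have "K ! (nat i - 1) \<in> key d c ` ?S" using that K(1,3) nth_mem[of "nat i - 1" K] by auto
    then show "f i \<in> ?S" "key d c (f i) = K ! (nat i - 1)"
      unfolding f_def using the_inv_into_into[OF injS] f_the_inv_into_f[OF injS] by auto
  qed
  have fsurj: "\<exists>i. 1 \<le> i \<and> i \<le> int d \<and> f i = x" if x: "x \<in> ?S" for x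
  proof -
    obtain n where "n < d" "K ! n = key d c x" 
      using imageI[OF x, of "key d c"] unfolding K(1)[symmetric] in_set_conv_nth K(3) by blast
    then show ?thesis
      using f(2)[of "int n + 1"] f(1)[of "int n + 1"] x injS
      by (intro exI[of _ "int n + 1"]) (auto dest: inj_onD simp: nat_add_distrib)
  qed
  \<comment> \<open>Oddness dictates the values at negative arguments; outside the range a
    permutation of it is the identity.\<close>
  define \<sigma> where "\<sigma> x = (if 1 \<le> x \<and> x \<le> int d then f x else if 1 \<le> - x \<and> - x \<le> int d then - f (- x) else x)" for x
  have "\<sigma> ` signed_range d \<subseteq> signed_range d"
  proof (rule image_subsetI)
    fix x assume "x \<in> signed_range d"
    then show "\<sigma> x \<in> signed_range d"
      using f(1)[of x] f(1)[of "- x"] by (auto simp: \<sigma>_def signed_range_def)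
  qed
  moreover have "signed_range d \<subseteq> \<sigma> ` signed_range d"
  proof
    fix x assume x: "x \<in> signed_range d"
    show "x \<in> \<sigma> ` signed_range d"
    proof (cases "0 \<le> entry c x")
      case True
      then obtain i where "1 \<le> i" "i \<le> int d" "f i = x" using fsurj[of x] x by blast
      then show ?thesis by (intro image_eqI[of _ _ i]) (auto simp: \<sigma>_def signed_range_def)
    next
      case False
      then have "0 \<le> entry c (- x)" using x by (auto simp: entry_minus signed_range_def)
      then obtain i where "1 \<le> i" "i \<le> int d" "f i = - x" using fsurj[of "- x"] x by (auto simp: signed_range_def)
      then show ?thesis by (intro image_eqI[of _ _ "- i"]) (auto simp: \<sigma>_def signed_range_def)
    qed
  qed
  ultimately have im: "\<sigma> ` signed_range d = signed_range d" by auto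
  have "bij_betw \<sigma> (signed_range d) (signed_range d)"
    using im by (simp add: bij_betw_def eq_card_imp_inj_on signed_range_def)
  then have "\<sigma> permutes signed_range d"
    by (rule bij_imp_permutes) (auto simp: \<sigma>_def signed_range_def)
  then have sp: "\<sigma> \<in> signed_perms d"
    by (auto simp: signed_perms_def \<sigma>_def)
  define a where "a i = (if i \<in> {1..d} then nat (entry c (f (int i))) else 0)" for i
  have ent: "entry c (\<sigma> j) = int (a (nat j))" if "1 \<le> j" "j \<le> int d" for j
    using f(1)[OF that] that by (auto simp: \<sigma>_def a_def)
  have "key d c (\<sigma> (int i)) < key d c (\<sigma> (int (Suc i)))" if "1 \<le> i" "i < d" for i
    using f(2)[of "int i"] f(2)[of "int (Suc i)"] that sorted_wrt_nth_less[OF K(2), of "i - 1" i] K(3)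
    by (auto simp: \<sigma>_def nat_add_distrib)
  moreover have "a i = 0" if "i \<notin> {1..d}" for i using that by (auto simp: a_def)
  ultimately have "a \<in> desc_seqs (descent d \<sigma>) d"
    using desc_seqs_iff_key[OF sp ent] by blast
  then show ?thesis using that sp place_eqI[OF sp assms ent] by blast
qed

section \<open>Statistics of a permutation and of its word\<close>

text \<open>The position of the label u + 1 up to sign. It serves to turn sums over positions of
  \<sigma> into sums over letters of the word.\<close>

definition pos :: "(int \<Rightarrow> int) \<Rightarrow> nat \<Rightarrow> int" where
  "pos \<sigma> u = \<bar>inv \<sigma> (int (Suc u))\<bar>"

lemma signed_perm_abs:
  assumes "\<sigma> \<in> signed_perms d"
  shows "\<bar>\<sigma> \<bar>x\<bar>\<bar> = \<bar>\<sigma> x\<bar>" "\<bar>inv \<sigma> \<bar>x\<bar>\<bar> = \<bar>inv \<sigma> x\<bar>"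
  using signed_perm_minus[OF assms, of x] signed_perm_inv_minus[OF assms, of x] by (auto simp: abs_if)

lemma bij_betw_pos:
  assumes "\<sigma> \<in> signed_perms d"
  shows "bij_betw (pos \<sigma>) {..<d} {1..int d}"
proof (rule bij_betw_byWitness[of _ "\<lambda>j. nat \<bar>\<sigma> j\<bar> - 1"])
  have r: "j \<in> {1..int d} \<Longrightarrow> \<sigma> j \<noteq> 0 \<and> \<bar>\<sigma> j\<bar> \<le> int d" for j
    using signed_perm_in(1)[OF assms, of j] by (auto simp: signed_range_def)
  have r': "u < d \<Longrightarrow> inv \<sigma> (int (Suc u)) \<noteq> 0 \<and> \<bar>inv \<sigma> (int (Suc u))\<bar> \<le> int d" for u
    using signed_perm_in(2)[OF assms, of "int (Suc u)"] by (auto simp: signed_range_def)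
  show "\<forall>u\<in>{..<d}. nat \<bar>\<sigma> (pos \<sigma> u)\<bar> - 1 = u"
    using assms by (auto simp: pos_def signed_perm_abs[OF assms] nat_add_distrib)
  show "\<forall>j\<in>{1..int d}. pos \<sigma> (nat \<bar>\<sigma> j\<bar> - 1) = j"
  proof
    fix j assume j: "j \<in> {1..int d}"
    then have "int (Suc (nat \<bar>\<sigma> j\<bar> - 1)) = \<bar>\<sigma> j\<bar>" using r[OF j] by auto
    then show "pos \<sigma> (nat \<bar>\<sigma> j\<bar> - 1) = j"
      using assms j unfolding pos_def by (simp only: signed_perm_abs[OF assms]) simp
  qed
  show "pos \<sigma> ` {..<d} \<subseteq> {1..int d}"
    using r' by (force simp: pos_def)
  show "(\<lambda>j. nat \<bar>\<sigma> j\<bar> - 1) ` {1..int d} \<subseteq> {..<d}"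
    using r by force
qed

lemma at_pos:
  assumes "\<sigma> \<in> signed_perms d" "u < d"
  shows "\<sigma> (pos \<sigma> u) = (if 0 \<le> place d \<sigma> a ! u then int (Suc u) else - int (Suc u))"
    and "int (a (nat (pos \<sigma> u))) = (if 0 \<le> place d \<sigma> a ! u then place d \<sigma> a ! u else - 1 - place d \<sigma> a ! u)"
proof -
  let ?j = "inv \<sigma> (int (Suc u))"
  have j: "?j \<noteq> 0"
    using signed_perm_in(2)[OF assms(1), of "int (Suc u)"] assms(2) by (auto simp: signed_range_def)
  have c: "place d \<sigma> a ! u = (if 0 < ?j then int (a (nat ?j)) else - int (a (nat (- ?j))) - 1)"
    using assms(2) by (simp add: place_def Let_def)
  have "\<sigma> (- ?j) = - int (Suc u)" using signed_perm_minus[OF assms(1), of ?j] assms(1) by simp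
  then show "\<sigma> (pos \<sigma> u) = (if 0 \<le> place d \<sigma> a ! u then int (Suc u) else - int (Suc u))"
    using c j signed_perm_inv(1)[OF assms(1), of "int (Suc u)"] by (auto simp: pos_def abs_if)
  show "int (a (nat (pos \<sigma> u))) = (if 0 \<le> place d \<sigma> a ! u then place d \<sigma> a ! u else - 1 - place d \<sigma> a ! u)"
    using c j by (auto simp: pos_def abs_if)
qed

lemma count_list_neg: "count_list (map sgn c) (- 1 :: int) = (\<Sum>u<length c. of_bool (c ! u < 0))"
  by (induction c) (auto simp: sum.lessThan_Suc_shift sgn_if simp del: sum.lessThan_Suc)

lemma abs_sum_nth: "abs_sum c = (\<Sum>u<length c. nat \<bar>c ! u\<bar>)"
  unfolding abs_sum_def by (induction c) (auto simp: sum.lessThan_Suc_shift simp del: sum.lessThan_Suc)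

definition pair_stat :: "int \<Rightarrow> int \<Rightarrow> nat" where
  "pair_stat x y = (if 0 \<le> x then of_bool (x < \<bar>y\<bar>) else 1 + of_bool (\<bar>y\<bar> < \<bar>x\<bar>))"

lemma length_filter_nth: "length (filter P xs) = (\<Sum>v<length xs. of_bool (P (xs ! v)))"
  by (induction xs) (auto simp: sum.lessThan_Suc_shift simp del: sum.lessThan_Suc)

lemma stat_pairs: "stat c = (\<Sum>v<length c. \<Sum>u<v. pair_stat (c ! u) (c ! v))"
proof (induction c)
  case (Cons x c)
  have "(\<Sum>v<length (x # c). \<Sum>u<v. pair_stat ((x # c) ! u) ((x # c) ! v))
     = (\<Sum>v<length c. pair_stat x (c ! v)) + (\<Sum>v<length c. \<Sum>u<v. pair_stat (c ! u) (c ! v))"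
    by (simp add: sum.lessThan_Suc_shift sum.distrib del: sum.lessThan_Suc)
  moreover have "(\<Sum>v<length c. pair_stat x (c ! v)) = (if 0 \<le> x then length (filter (\<lambda>y. x < \<bar>y\<bar>) c)
      else length c + length (filter (\<lambda>y. \<bar>y\<bar> < \<bar>x\<bar>) c))"
    unfolding length_filter_nth pair_stat_def by (auto simp: sum_Suc)
  ultimately show ?case using Cons by simp
qed simp

lemma sum_square_triangle:
  fixes T :: "nat \<Rightarrow> nat \<Rightarrow> nat"
  assumes "\<And>u. T u u = 0"
  shows "(\<Sum>u<d. \<Sum>v<d. T u v) = (\<Sum>v<d. \<Sum>u<v. T u v + T v u)"
  by (induction d) (simp_all add: sum.distrib assms)

text \<open>There are d - Suc u indices v with u < v < d; this spreads the second sum of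
  \<open>length_D\<close> over pairs.\<close>

lemma sum_weighted_triangle:
  "(\<Sum>u<d. if P u then d - Suc u else 0) = (\<Sum>v<d. \<Sum>u<v. of_bool (P u))"
proof (induction d)
  case (Suc d)
  have "(\<Sum>u<d. if P u then Suc d - Suc u else 0) = (\<Sum>u<d. (if P u then d - Suc u else 0) + of_bool (P u))"
    by (rule sum.cong) auto
  then show ?case using Suc by (simp add: sum.distrib)
qed simp

context
  fixes d \<sigma> a c
  assumes s: "\<sigma> \<in> signed_perms d" and a: "a \<in> desc_seqs (descent d \<sigma>) d"
    and c_def: "c = place d \<sigma> a"
begin

lemma negatives_place: "card {i\<in>{1..int d}. \<sigma> i < 0} = count_list (map sgn c) (- 1)"
proof -
  have "card {i\<in>{1..int d}. \<sigma> i < 0} = (\<Sum>i\<in>{1..int d}. of_bool (\<sigma> i < 0))"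
    by (simp add: Int_def)
  also have "\<dots> = (\<Sum>u<d. of_bool (\<sigma> (pos \<sigma> u) < 0))"
    by (rule sum.reindex_bij_betw[OF bij_betw_pos[OF s], symmetric])
  also have "\<dots> = (\<Sum>u<d. of_bool (c ! u < 0))"
    by (rule sum.cong) (auto simp: at_pos[OF s, of _ a] c_def)
  finally show ?thesis by (simp add: count_list_neg c_def)
qed

text \<open>A value a placed on a negative label becomes a letter of absolute value a + 1, and the
  excess is counted by the negatives.\<close>

lemma weight_place: "(\<Sum>i=1..d. a i) + card {i\<in>{1..int d}. \<sigma> i < 0} = abs_sum c"
proof -
  have "(\<Sum>i=1..d. a i) = (\<Sum>i\<in>{1..int d}. a (nat i))"
    by (rule sum.reindex_bij_witness[of _ nat int]) auto
  also have "\<dots> = (\<Sum>u<d. a (nat (pos \<sigma> u)))"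
    by (rule sum.reindex_bij_betw[OF bij_betw_pos[OF s], symmetric])
  finally have "(\<Sum>i=1..d. a i) + card {i\<in>{1..int d}. \<sigma> i < 0}
      = (\<Sum>u<d. a (nat (pos \<sigma> u)) + of_bool (c ! u < 0))"
    by (simp only: negatives_place count_list_neg sum.distrib) (simp add: c_def)
  also have "\<dots> = (\<Sum>u<d. nat \<bar>c ! u\<bar>)"
  proof (rule sum.cong[OF refl])
    fix u assume "u \<in> {..<d}"
    then show "a (nat (pos \<sigma> u)) + of_bool (c ! u < 0) = nat \<bar>c ! u\<bar>"
      using at_pos(2)[OF s, of u a] by (auto simp: c_def split: if_splits)
  qed
  finally show ?thesis by (simp add: abs_sum_nth c_def)
qed

lemma pos_less_iff:
  assumes "u < d" "v < d"
  shows "pos \<sigma> u < pos \<sigma> v \<longleftrightarrow> key d c (\<sigma> (pos \<sigma> u)) < key d c (\<sigma> (pos \<sigma> v))"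
proof -
  have mono: "key d c (\<sigma> i) < key d c (\<sigma> j)" if "1 \<le> i" "i < j" "j \<le> int d" for i j
    using key_strict_mono[OF s a, of "nat i" "nat j"] that by (simp add: c_def)
  have "pos \<sigma> u \<in> {1..int d}" "pos \<sigma> v \<in> {1..int d}"
    using bij_betw_imp_surj_on[OF bij_betw_pos[OF s]] assms by auto
  then show ?thesis
    using mono[of "pos \<sigma> u" "pos \<sigma> v"] mono[of "pos \<sigma> v" "pos \<sigma> u"]
    by (cases "pos \<sigma> u" "pos \<sigma> v" rule: linorder_cases) auto
qed

text \<open>Both sums of \<open>length_D\<close> are rewritten over pairs of letters u < v and then
  compared with \<open>pair_stat\<close> pair by pair. The order of two positions is the order of
  the keys of their labels.\<close>

lemma length_D_place: "length_D d \<sigma> = stat c"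
proof -
  let ?P = "{1..int d}"
  let ?inv = "\<lambda>x y. x * y * (x - y) > (0 :: int)"
  define T where "T u v = (of_bool (pos \<sigma> u < pos \<sigma> v \<and> ?inv (\<sigma> (pos \<sigma> u)) (\<sigma> (pos \<sigma> v))) :: nat)" for u v
  have "{(i, j). 0 < i \<and> i < j \<and> j \<le> int d \<and> ?inv (\<sigma> i) (\<sigma> j)}
      = {p\<in>?P \<times> ?P. fst p < snd p \<and> ?inv (\<sigma> (fst p)) (\<sigma> (snd p))}" by auto
  then have "card {(i, j). 0 < i \<and> i < j \<and> j \<le> int d \<and> ?inv (\<sigma> i) (\<sigma> j)}
      = (\<Sum>p\<in>?P \<times> ?P. of_bool (fst p < snd p \<and> ?inv (\<sigma> (fst p)) (\<sigma> (snd p))))"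
    by (simp add: Int_def)
  also have "\<dots> = (\<Sum>i\<in>?P. \<Sum>j\<in>?P. of_bool (i < j \<and> ?inv (\<sigma> i) (\<sigma> j)))"
    unfolding sum.cartesian_product by (rule sum.cong) auto
  also have "\<dots> = (\<Sum>u<d. \<Sum>j\<in>?P. of_bool (pos \<sigma> u < j \<and> ?inv (\<sigma> (pos \<sigma> u)) (\<sigma> j)))"
    by (rule sum.reindex_bij_betw[OF bij_betw_pos[OF s], symmetric])
  also have "\<dots> = (\<Sum>u<d. \<Sum>v<d. T u v)"
    unfolding T_def by (intro sum.cong refl sum.reindex_bij_betw[OF bij_betw_pos[OF s], symmetric])
  also have "\<dots> = (\<Sum>v<d. \<Sum>u<v. T u v + T v u)"
    by (rule sum_square_triangle) (simp add: T_def)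
  finally have inversions: "card {(i, j). 0 < i \<and> i < j \<and> j \<le> int d \<and> ?inv (\<sigma> i) (\<sigma> j)}
      = (\<Sum>v<d. \<Sum>u<v. T u v + T v u)" .
  have "(\<Sum>i\<in>{i\<in>?P. \<sigma> i < 0}. nat (int d + \<sigma> i)) = (\<Sum>i\<in>?P. if \<sigma> i < 0 then nat (int d + \<sigma> i) else 0)"
    by (rule sum.inter_filter) simp
  also have "\<dots> = (\<Sum>u<d. if \<sigma> (pos \<sigma> u) < 0 then nat (int d + \<sigma> (pos \<sigma> u)) else 0)"
    by (rule sum.reindex_bij_betw[OF bij_betw_pos[OF s], symmetric])
  also have "\<dots> = (\<Sum>u<d. if c ! u < 0 then d - Suc u else 0)"
    by (rule sum.cong) (auto simp: at_pos[OF s, of _ a] c_def)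
  also have "\<dots> = (\<Sum>v<d. \<Sum>u<v. of_bool (c ! u < 0))"
    by (rule sum_weighted_triangle)
  finally have "length_D d \<sigma> = (\<Sum>v<d. \<Sum>u<v. T u v + T v u + of_bool (c ! u < 0))"
    unfolding length_D_def inversions by (simp add: sum.distrib)
  also have "\<dots> = (\<Sum>v<d. \<Sum>u<v. pair_stat (c ! u) (c ! v))"
  proof (intro sum.cong refl)
    fix v u assume "v \<in> {..<d}" "u \<in> {..<v}"
    then have uv: "u < v" "u < d" "v < d" by auto
    define x where "x = \<sigma> (pos \<sigma> u)"
    define y where "y = \<sigma> (pos \<sigma> v)"
    have x: "x = (if 0 \<le> c ! u then int (Suc u) else - int (Suc u))"
      and y: "y = (if 0 \<le> c ! v then int (Suc v) else - int (Suc v))"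
      unfolding x_def y_def c_def using at_pos(1)[OF s] uv by auto
    have ex: "entry c x = (if 0 \<le> c ! u then c ! u else - 1 - c ! u)"
      and ey: "entry c y = (if 0 \<le> c ! v then c ! v else - 1 - c ! v)"
      unfolding x y entry_def by (auto simp: nat_add_distrib)
    have r: "x \<in> signed_range d" "y \<in> signed_range d" using x y uv by (auto simp: signed_range_def)
    \<comment> \<open>Here |x| < |y|, so x - y has the sign of - y and the product x y (x - y) has
      the sign of - x.\<close>
    have inv: "?inv x y \<longleftrightarrow> x < 0" "?inv y x \<longleftrightarrow> 0 < x"
      unfolding x y using uv(1) by (auto simp: zero_less_mult_iff mult_less_0_iff)
    have "T u v = of_bool ((entry c y < entry c x \<or> entry c x = entry c y \<and> x < y) \<and> x < 0)"
      "T v u = of_bool ((entry c x < entry c y \<or> entry c y = entry c x \<and> y < x) \<and> 0 < x)"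
      unfolding T_def pos_less_iff[OF uv(2,3)] pos_less_iff[OF uv(3,2)] x_def[symmetric] y_def[symmetric] inv
        key_less_iff[OF r] key_less_iff[OF r(2,1)] by rule+
    \<comment> \<open>For letters of opposite signs a tie between the entries is counted, for equal
      signs it is not. As the entry belonging to a negative letter is its absolute value minus 1,
      both cases become strict comparisons of absolute values.\<close>
    then show "T u v + T v u + of_bool (c ! u < 0) = pair_stat (c ! u) (c ! v)"
      unfolding ex ey unfolding x y pair_stat_def using uv(1) by (auto simp: abs_if split: if_splits)
  qed
  also have "\<dots> = stat c" by (simp add: stat_pairs c_def)
  finally show ?thesis .
qed

end

section \<open>The permutation side as a generating function of words\<close>

lemma even_signed_perms_eq:
  "even_signed_perms d = {\<sigma>\<in>signed_perms d. even (card {i\<in>{1..int d}. \<sigma> i < 0})}"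
  by (auto simp: even_signed_perms_def signed_perms_def signed_range_def)

lemma finite_even_signed_perms: "finite (even_signed_perms d)"
  by (rule finite_subset[OF _ finite_permutations[of "{- int d..int d} - {0}"]])
    (auto simp: even_signed_perms_def)

lemma Wmaj_descent: "Wmaj d \<sigma> = (\<Sum>i=1..d. i * descent d \<sigma> i) + card {i\<in>{1..int d}. \<sigma> i < 0}"
proof -
  have "(\<Sum>i=1..d. i * descent d \<sigma> i) = (\<Sum>i\<in>{i\<in>{1..d}. i < d \<and> \<sigma> (int i) > \<sigma> (int i + 1)}. i)"
    by (subst sum.inter_filter) (auto simp: descent_def intro!: sum.cong)
  also have "\<dots> = (\<Sum>i\<in>{i\<in>{1..<int d}. \<sigma> i > \<sigma> (i + 1)}. nat i)"
    by (rule sum.reindex_bij_witness[of _ nat int]) auto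
  finally show ?thesis by (simp add: Wmaj_def)
qed

lemma M_D_eq_gf:
  "M_D q d * (\<Prod>j=1..d. 1 / (1 - fps_X ^ j))
    = gf {c. length c = d \<and> even (count_list (map sgn c) (-1))} abs_sum (\<lambda>c. of_nat q ^ stat c)"
proof -
  let ?neg = "\<lambda>\<sigma>. card {i\<in>{1..int d}. \<sigma> i < 0}"
  let ?D = "even_signed_perms d"
  let ?A = "\<lambda>\<sigma>. desc_seqs (descent d \<sigma>) d"
  let ?C = "{c :: int list. length c = d \<and> even (count_list (map sgn c) (-1))}"
  let ?w = "\<lambda>(\<sigma>, a). (\<Sum>i=1..d. a i) + ?neg \<sigma>"
  have bij: "bij_betw (\<lambda>(\<sigma>, a). place d \<sigma> a) (Sigma ?D ?A) ?C"
    unfolding bij_betw_def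
  proof
    show "inj_on (\<lambda>(\<sigma>, a). place d \<sigma> a) (Sigma ?D ?A)"
      by (rule inj_on_subset[OF inj_on_place]) (auto simp: even_signed_perms_eq)
    show "(\<lambda>(\<sigma>, a). place d \<sigma> a) ` Sigma ?D ?A = ?C"
    proof (intro equalityI subsetI)
      fix c assume c: "c \<in> ?C"
      then obtain \<sigma> a where *: "\<sigma> \<in> signed_perms d" "a \<in> ?A \<sigma>" "place d \<sigma> a = c"
        using place_surj[of c d] by auto
      then have "\<sigma> \<in> ?D"
        using negatives_place[OF *(1,2) *(3)[symmetric]] c by (auto simp: even_signed_perms_eq)
      then show "c \<in> (\<lambda>(\<sigma>, a). place d \<sigma> a) ` Sigma ?D ?A" using * by force
    qed (use negatives_place[OF _ _ refl] in \<open>auto simp: even_signed_perms_eq\<close>)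
  qed
  have w: "abs_sum ((\<lambda>(\<sigma>, a). place d \<sigma> a) p) = ?w p" if "p \<in> Sigma ?D ?A" for p
    using that weight_place[OF _ _ refl] by (auto simp: even_signed_perms_eq)
  have l: "of_nat q ^ stat ((\<lambda>(\<sigma>, a). place d \<sigma> a) p) = (of_nat q ^ length_D d (fst p) :: rat)"
    if "p \<in> Sigma ?D ?A" for p
    using that length_D_place[OF _ _ refl] by (auto simp: even_signed_perms_eq)
  \<comment> \<open>Finiteness is carried over from words along the inverse bijection.\<close>
  have fin: "finite_fibres (Sigma ?D ?A) ?w"
  proof (rule finite_fibres_image)
    show "finite_fibres ?C abs_sum" using finite_fibres_int_lists[of d] by (rule finite_fibres_subset) auto
    let ?g = "inv_into (Sigma ?D ?A) (\<lambda>(\<sigma>, a). place d \<sigma> a)"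
    show "Sigma ?D ?A \<subseteq> ?g ` ?C" using bij_betw_inv_into[OF bij] by (simp add: bij_betw_def)
    show "?w (?g c) = abs_sum c" if "c \<in> ?C" for c
      using w[of "?g c"] that bij_betw_inv_into_right[OF bij that] bij_betwE[OF bij_betw_inv_into[OF bij]]
      by (metis (no_types, lifting))
  qed
  have "gf ?C abs_sum (\<lambda>c. of_nat q ^ stat c) = gf (Sigma ?D ?A) ?w (\<lambda>p. of_nat q ^ length_D d (fst p))"
    by (rule gf_bij_betw[OF bij, symmetric]) (use w l in auto)
  also have "\<dots> = (\<Sum>\<sigma>\<in>?D. gf {p\<in>Sigma ?D ?A. fst p = \<sigma>} ?w (\<lambda>p. of_nat q ^ length_D d (fst p)))"
    by (rule gf_partition[OF fin finite_even_signed_perms]) auto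
  also have "\<dots> = (\<Sum>\<sigma>\<in>?D. fps_const (of_nat q ^ length_D d \<sigma>) * fps_X ^ Wmaj d \<sigma>
      * (\<Prod>j=1..d. 1 / (1 - fps_X ^ j)))"
  proof (rule sum.cong[OF refl])
    fix \<sigma> assume \<sigma>: "\<sigma> \<in> ?D"
    have "gf {p\<in>Sigma ?D ?A. fst p = \<sigma>} ?w (\<lambda>p. of_nat q ^ length_D d (fst p))
        = gf (?A \<sigma>) (\<lambda>a. ?neg \<sigma> + (\<Sum>i=1..d. a i)) (\<lambda>a. of_nat q ^ length_D d \<sigma> * 1)"
    proof (rule gf_bij_betw[of snd])
      show "bij_betw snd {p\<in>Sigma ?D ?A. fst p = \<sigma>} (?A \<sigma>)"
        using \<sigma> by (intro bij_betw_byWitness[of _ "Pair \<sigma>"]) auto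
    qed auto
    \<comment> \<open>The forced drops contribute the sum of the descent positions; with the number
      of negatives this is \<open>Wmaj\<close>.\<close>
    also have "\<dots> = fps_const (of_nat q ^ length_D d \<sigma>) * fps_X ^ ?neg \<sigma>
        * (fps_X ^ (\<Sum>i=1..d. i * descent d \<sigma> i) * (\<Prod>j=1..d. 1 / (1 - fps_X ^ j)))"
      unfolding gf_scale_shift gf_desc_seqs[THEN conjunct2] ..
    finally show "gf {p\<in>Sigma ?D ?A. fst p = \<sigma>} ?w (\<lambda>p. of_nat q ^ length_D d (fst p))
        = fps_const (of_nat q ^ length_D d \<sigma>) * fps_X ^ Wmaj d \<sigma> * (\<Prod>j=1..d. 1 / (1 - fps_X ^ j))"
      by (simp add: Wmaj_descent power_add mult_ac)
  qed
  finally show ?thesis by (simp add: M_D_def sum_distrib_right)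
qed

section \<open>Counting subspaces\<close>

lemma card_fibres:
  assumes "finite A" "finite B" "f ` A \<subseteq> B" "\<And>y. y \<in> B \<Longrightarrow> card {x\<in>A. f x = y} = k"
  shows "card A = card B * k"
proof -
  have "card A = (\<Sum>y\<in>B. card {x\<in>A. f x = y})"
    using sum.group[OF assms(1-3), of "\<lambda>_. 1 :: nat"] by simp
  then show ?thesis using assms(4) by simp
qed

text \<open>The number of admissible new heads depends on the length alone. Both independent lists
  and frames are counted this way.\<close>

lemma card_lists_extend:
  fixes P :: "'x::finite list \<Rightarrow> bool"
  assumes "P []" "\<And>x xs. P (x # xs) \<Longrightarrow> P xs" "\<And>xs. P xs \<Longrightarrow> card {x. P (x # xs)} = f (length xs)"
  shows "card {xs. P xs \<and> length xs = n} = (\<Prod>i<n. f i)"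
proof (induction n)
  case 0
  have "{xs. P xs \<and> length xs = 0} = {[]}" using assms(1) by auto
  then show ?case by simp
next
  case (Suc n)
  have fin: "finite {xs. P xs \<and> length xs = m}" for m
    by (rule finite_subset[OF _ finite_lists_length_eq[of UNIV m]]) auto
  have "card {xs. P xs \<and> length xs = Suc n} = card {xs. P xs \<and> length xs = n} * f n"
  proof (rule card_fibres[OF fin fin])
    show "tl ` {xs. P xs \<and> length xs = Suc n} \<subseteq> {xs. P xs \<and> length xs = n}"
      using assms(2) by (auto simp: length_Suc_conv)
    fix xs assume xs: "xs \<in> {xs. P xs \<and> length xs = n}"
    have "{ys \<in> {xs. P xs \<and> length xs = Suc n}. tl ys = xs} = (\<lambda>x. x # xs) ` {x. P (x # xs)}"
    proof (intro equalityI subsetI)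
      fix ys assume "ys \<in> {ys \<in> {xs. P xs \<and> length xs = Suc n}. tl ys = xs}"
      then show "ys \<in> (\<lambda>x. x # xs) ` {x. P (x # xs)}" by (cases ys) auto
    qed (use xs in auto)
    then show "card {ys \<in> {xs. P xs \<and> length xs = Suc n}. tl ys = xs} = f n"
      using assms(3)[of xs] xs by (simp add: card_image inj_on_def)
  qed
  then show ?case using Suc by simp
qed

lemma card_field_ge_2: "CARD('a::{field,finite}) \<ge> 2"
  using card_mono[of "UNIV :: 'a set" "{0, 1}"] by simp

lemma card_span_insert:
  fixes S :: "('a::{field,finite} ^ 'n::finite) set"
  assumes "x \<notin> vec.span S"
  shows "card (vec.span (insert x S)) = CARD('a) * card (vec.span S)"
proof -
  let ?f = "\<lambda>(k, v). k *s x + v"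
  have "bij_betw ?f (UNIV \<times> vec.span S) (vec.span (insert x S))"
    unfolding bij_betw_def
  proof
    show "inj_on ?f (UNIV \<times> vec.span S)"
    proof (rule inj_onI, clarify)
      fix k v l w assume *: "v \<in> vec.span S" "w \<in> vec.span S" "k *s x + v = l *s x + w"
      then have "(k - l) *s x = w - v" by (simp add: vec.scale_left_diff_distrib algebra_simps)
      then have "(k - l) *s x \<in> vec.span S" using * by (simp add: vec.span_diff)
      moreover have "m = 0" if "m *s x \<in> vec.span S" for m
        using assms vec.span_scale[OF that, of "inverse m"] by (cases "m = 0") auto
      ultimately have "k - l = 0" by blast
      then show "k = l \<and> v = w" using *(3) by simp
    qed
    show "?f ` (UNIV \<times> vec.span S) = vec.span (insert x S)"
    proof (intro equalityI subsetI)
      fix v assume "v \<in> vec.span (insert x S)"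
      then obtain k where "v - k *s x \<in> vec.span S" unfolding vec.span_insert by blast
      then show "v \<in> ?f ` (UNIV \<times> vec.span S)"
        by (intro image_eqI[of _ _ "(k, v - k *s x)"]) auto
    next
      fix v assume "v \<in> ?f ` (UNIV \<times> vec.span S)"
      then obtain k w where "v = k *s x + w" "w \<in> vec.span S" by auto
      then show "v \<in> vec.span (insert x S)" unfolding vec.span_insert by (auto intro!: exI[of _ k])
    qed
  qed
  then have "card (UNIV \<times> vec.span S :: ('a \<times> _) set) = card (vec.span (insert x S))"
    by (rule bij_betw_same_card)
  then show ?thesis by (simp add: card_cartesian_product)
qed

lemma card_span:
  fixes S :: "('a::{field,finite} ^ 'n::finite) set"
  shows "card (vec.span S) = CARD('a) ^ vec.dim S"
proof -
  have "finite S" by simp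
  then show ?thesis
  proof (induction S)
    case (insert x S)
    then show ?case using card_span_insert[of x S]
      by (cases "x \<in> vec.span S") (simp_all add: vec.dim_insert vec.span_redundant)
  qed simp
qed

lemma card_subspace:
  fixes V :: "('a::{field,finite} ^ 'n::finite) set"
  shows "vec.subspace V \<Longrightarrow> card V = CARD('a) ^ vec.dim V"
  using card_span[of V] by (simp add: vec.span_eq_iff[THEN iffD2])

section \<open>Independent lists and Gaussian binomials\<close>

text \<open>Linear independence in the quotient by the span of \<open>U\<close>. It is phrased for
  lists so that ordered bases can be counted vector by vector.\<close>

fun indep_mod :: "('a::field ^ 'n::finite) set \<Rightarrow> ('a ^ 'n) list \<Rightarrow> bool" where
  "indep_mod U [] = True"
| "indep_mod U (x # xs) = (x \<notin> vec.span (U \<union> set xs) \<and> indep_mod U xs)"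

lemma dim_indep_mod: "indep_mod U xs \<Longrightarrow> vec.dim (U \<union> set xs) = vec.dim U + length xs"
  by (induction xs) (auto simp: vec.dim_insert)

lemma indep_mod_mono: "indep_mod U xs \<Longrightarrow> W \<subseteq> U \<Longrightarrow> indep_mod W xs"
proof (induction xs)
  case (Cons x xs)
  have "vec.span (W \<union> set xs) \<subseteq> vec.span (U \<union> set xs)" using Cons.prems by (intro vec.span_mono) auto
  then show ?case using Cons by auto
qed simp

lemma card_indep_mod:
  fixes V :: "('a::{field,finite} ^ 'n::finite) set"
  assumes "vec.subspace V" "U \<subseteq> V"
  shows "card {xs. (indep_mod U xs \<and> set xs \<subseteq> V) \<and> length xs = n}
    = (\<Prod>i<n. CARD('a) ^ vec.dim V - CARD('a) ^ (vec.dim U + i))"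
proof (rule card_lists_extend)
  fix xs assume xs: "indep_mod U xs \<and> set xs \<subseteq> V"
  have "vec.span (U \<union> set xs) \<subseteq> V" using xs assms by (intro vec.span_minimal) auto
  moreover have "{x. indep_mod U (x # xs) \<and> set (x # xs) \<subseteq> V} = V - vec.span (U \<union> set xs)"
    using xs by auto
  ultimately show "card {x. indep_mod U (x # xs) \<and> set (x # xs) \<subseteq> V}
      = CARD('a) ^ vec.dim V - CARD('a) ^ (vec.dim U + length xs)"
    using xs by (simp add: card_Diff_subset card_span dim_indep_mod card_subspace[OF assms(1)])
qed auto

text \<open>Group the independent lists of length j in V by their span; all j-dimensional subspaces
  have equally many ordered bases.\<close>

lemma card_subspaces:
  fixes V :: "('a::{field,finite} ^ 'n::finite) set"
  assumes "vec.subspace V"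
  shows "card {W. vec.subspace W \<and> W \<subseteq> V \<and> vec.dim W = j} * (\<Prod>i<j. CARD('a) ^ j - CARD('a) ^ i)
    = (\<Prod>i<j. CARD('a) ^ vec.dim V - CARD('a) ^ i)"
proof -
  let ?L = "\<lambda>V. {xs. (indep_mod {} xs \<and> set xs \<subseteq> V) \<and> length xs = j}"
  let ?W = "{W. vec.subspace W \<and> W \<subseteq> V \<and> vec.dim W = j}"
  have "card (?L V) = card ?W * (\<Prod>i<j. CARD('a) ^ j - CARD('a) ^ i)"
  proof (rule card_fibres)
    show "finite (?L V)" by (rule finite_subset[OF _ finite_lists_length_eq[of UNIV j]]) auto
    show "(\<lambda>xs. vec.span (set xs)) ` ?L V \<subseteq> ?W"
    proof clarify
      fix xs assume "indep_mod {} xs" "set xs \<subseteq> V" "j = length xs"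
      then show "vec.subspace (vec.span (set xs)) \<and> vec.span (set xs) \<subseteq> V \<and> vec.dim (vec.span (set xs)) = length xs"
        using dim_indep_mod[of "{}" xs] assms by (auto simp: vec.span_minimal)
    qed
    fix W assume W: "W \<in> ?W"
    have "{xs\<in>?L V. vec.span (set xs) = W} = ?L W"
    proof (intro equalityI subsetI)
      fix xs assume xs: "xs \<in> ?L W"
      have "vec.dim (vec.span (set xs)) = j" using dim_indep_mod[of "{}" xs] xs by auto
      moreover have "vec.span (set xs) \<subseteq> W" using xs W vec.span_minimal[of "set xs" W] by auto
      ultimately have "vec.span (set xs) = W" using W by (intro vec.subspace_dim_equal) auto
      then show "xs \<in> {xs\<in>?L V. vec.span (set xs) = W}" using xs W by auto
    qed (use vec.span_superset in auto)
    then show "card {xs\<in>?L V. vec.span (set xs) = W} = (\<Prod>i<j. CARD('a) ^ j - CARD('a) ^ i)"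
      using card_indep_mod[of W "{}" j] W by simp
  qed simp
  then show ?thesis using card_indep_mod[OF assms, of "{}" j] by simp
qed

lemma qfact_nonzero: "q > 1 \<Longrightarrow> qfact q n \<noteq> 0"
proof (induction n)
  case (Suc n)
  then have "1 < q ^ Suc n" by (intro one_less_power) auto
  then show ?case using Suc by simp
qed simp

text \<open>The i-th factor is q^i (q^(v - i) - 1): the powers of q collect to exponent (j choose
  2), the rest are the top j factors of \<open>qfact\<close>.\<close>

lemma prod_qfact:
  assumes "j \<le> v" "q \<ge> 1"
  shows "of_nat (\<Prod>i<j. q ^ v - q ^ i) * qfact (of_nat q) (v - j) = of_nat q ^ (j choose 2) * qfact (of_nat q) v"
  using assms(1)
proof (induction j)
  case (Suc j)
  then have v: "v - j = Suc (v - Suc j)" by simp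
  have "of_nat (q ^ v - q ^ j) = of_nat q ^ j * (of_nat q ^ (v - j) - 1 :: rat)"
    using Suc.prems assms(2) by (simp add: of_nat_diff power_increasing algebra_simps flip: power_add)
  then have "of_nat (\<Prod>i<Suc j. q ^ v - q ^ i) * qfact (of_nat q) (v - Suc j)
      = of_nat q ^ j * (of_nat (\<Prod>i<j. q ^ v - q ^ i) * qfact (of_nat q) (v - j))"
    unfolding v by (simp add: mult_ac)
  also have "\<dots> = of_nat q ^ (j + (j choose 2)) * qfact (of_nat q) v"
    using Suc by (simp add: power_add)
  finally show ?case by (simp add: numeral_2_eq_2)
qed (simp add: numeral_2_eq_2)

lemma card_subspaces_qfact:
  fixes V :: "('a::{field,finite} ^ 'n::finite) set"
  assumes "vec.subspace V" "j \<le> vec.dim V" "q = of_nat (CARD('a))"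
  shows "of_nat (card {W. vec.subspace W \<and> W \<subseteq> V \<and> vec.dim W = j}) * (qfact q (vec.dim V - j) * qfact q j)
    = qfact q (vec.dim V)"
proof -
  let ?N = "of_nat (card {W. vec.subspace W \<and> W \<subseteq> V \<and> vec.dim W = j}) :: rat"
  have q: "CARD('a) \<ge> 1" "q \<noteq> 0" using card_field_ge_2[where 'a='a] assms(3) by auto
  have "?N * of_nat (\<Prod>i<j. CARD('a) ^ j - CARD('a) ^ i) * qfact q (vec.dim V - j)
      = of_nat (\<Prod>i<j. CARD('a) ^ vec.dim V - CARD('a) ^ i) * qfact q (vec.dim V - j)"
    unfolding card_subspaces[OF assms(1), of j, symmetric] by simp
  moreover have "of_nat (\<Prod>i<j. CARD('a) ^ j - CARD('a) ^ i) = q ^ (j choose 2) * qfact q j"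
    using prod_qfact[of j j, OF _ q(1)] assms(3) by simp
  moreover have "of_nat (\<Prod>i<j. CARD('a) ^ vec.dim V - CARD('a) ^ i) * qfact q (vec.dim V - j)
      = q ^ (j choose 2) * qfact q (vec.dim V)"
    using prod_qfact[OF assms(2) q(1)] assms(3) by simp
  ultimately have "?N * (q ^ (j choose 2) * qfact q j) * qfact q (vec.dim V - j) = q ^ (j choose 2) * qfact q (vec.dim V)"
    by metis
  then have "q ^ (j choose 2) * (?N * (qfact q (vec.dim V - j) * qfact q j)) = q ^ (j choose 2) * qfact q (vec.dim V)"
    by (simp only: mult_ac)
  then show ?thesis using q(2) by simp
qed

text \<open>Both sides are the same Gaussian binomial. This is the link between the recursion for
  words and the one for flags.\<close>

lemma card_subspaces_signs_gf:
  fixes V :: "('a::{field,finite} ^ 'n::finite) set"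
  assumes "vec.subspace V" "j \<le> vec.dim V" "q = of_nat (CARD('a))"
  shows "of_nat (card {W. vec.subspace W \<and> W \<subseteq> V \<and> vec.dim W = j}) = signs_gf q (vec.dim V - j) j 0"
proof -
  have "q > 1" using card_field_ge_2[where 'a='a] assms(3) by simp
  then have nz: "qfact q (vec.dim V - j) * qfact q j \<noteq> 0" using qfact_nonzero by simp
  have "signs_gf q (vec.dim V - j) j 0 * (qfact q (vec.dim V - j) * qfact q j) = qfact q (vec.dim V)"
    using signs_gf_qfact[of q "vec.dim V - j" j 0] assms(2) by (simp add: numeral_2_eq_2)
  with card_subspaces_qfact[OF assms] show ?thesis
    by (rule mult_right_cancel[OF nz, THEN iffD1, OF trans[OF _ sym]])
qed

section \<open>Isotropic subspaces\<close>

text \<open>The polar form of \<open>hyp_form\<close>.\<close>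

definition bilin :: "'a::field ^ ('d::finite + 'd) \<Rightarrow> 'a ^ ('d + 'd) \<Rightarrow> 'a" where
  "bilin x y = (\<Sum>i\<in>UNIV. x $ Inl i * y $ Inr i + x $ Inr i * y $ Inl i)"

lemma hyp_form_add: "hyp_form (x + y) = hyp_form x + hyp_form y + bilin x y"
  by (simp add: hyp_form_def hyp_plane_form_def bilin_def sum.distrib[symmetric] algebra_simps)

lemma hyp_form_scale: "hyp_form (k *s x) = k * k * hyp_form x"
  by (simp add: hyp_form_def hyp_plane_form_def sum_distrib_left mult_ac)

lemma bilin_sym: "bilin x y = bilin y x"
  by (simp add: bilin_def mult_ac add_ac)

lemma bilin_add_left: "bilin (x + y) z = bilin x z + bilin y z"
  by (simp add: bilin_def sum.distrib[symmetric] algebra_simps)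

lemma bilin_scale_left: "bilin (k *s x) z = k * bilin x z"
  by (simp add: bilin_def sum_distrib_left algebra_simps)

lemma bilin_diff_left: "bilin (x - y) z = bilin x z - bilin y z"
  using bilin_add_left[of "x - y" y z] by simp

lemma bilin_zero_left [simp]: "bilin 0 z = 0"
  by (simp add: bilin_def)

text \<open>Pairing with the basis vector of the partner coordinate in the same plane reads off a
  coordinate.\<close>

lemma bilin_nondegenerate:
  assumes "\<And>y. bilin x y = 0"
  shows "x = 0"
proof (rule vec_eq_iff[THEN iffD2], rule allI)
  fix i
  have "x $ i = bilin x (axis (case i of Inl j \<Rightarrow> Inr j | Inr j \<Rightarrow> Inl j) 1)"
    by (cases i) (simp_all add: bilin_def axis_def if_distrib[of "\<lambda>t. _ * t"] cong: if_cong)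
  then show "x $ i = 0 $ i" using assms by simp
qed

definition perp :: "('a::field ^ ('d::finite + 'd)) set \<Rightarrow> ('a ^ ('d + 'd)) set" where
  "perp S = {x. \<forall>y\<in>S. bilin x y = 0}"

lemma subspace_perp: "vec.subspace (perp S)"
  by (rule vec.subspaceI) (auto simp: perp_def bilin_add_left bilin_scale_left)

lemma perp_Un: "perp (S \<union> T) = perp S \<inter> perp T"
  by (auto simp: perp_def)

lemma perp_span: "perp (vec.span S) = perp S"
proof
  show "perp S \<subseteq> perp (vec.span S)"
  proof
    fix x assume x: "x \<in> perp S"
    have "S \<subseteq> perp {x}" using x by (auto simp: perp_def bilin_sym[of _ x])
    then have "vec.span S \<subseteq> perp {x}" by (rule vec.span_minimal) (rule subspace_perp)
    then show "x \<in> perp (vec.span S)" by (auto simp: perp_def bilin_sym[of x])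
  qed
qed (use vec.span_superset in \<open>auto simp: perp_def\<close>)

lemma card_level_set:
  fixes K :: "('a::{field,finite} ^ ('d::finite + 'd)) set"
  assumes "vec.subspace K" "z\<^sub>0 \<in> K" "map (bilin z\<^sub>0) ys = vs"
  shows "card {z\<in>K. map (bilin z) ys = vs} = card (K \<inter> perp (set ys))"
proof (rule bij_betw_same_card)
  show "bij_betw (\<lambda>z. z - z\<^sub>0) {z\<in>K. map (bilin z) ys = vs} (K \<inter> perp (set ys))"
  proof (rule bij_betw_byWitness[of _ "\<lambda>z. z + z\<^sub>0"])
    show "(\<lambda>z. z - z\<^sub>0) ` {z\<in>K. map (bilin z) ys = vs} \<subseteq> K \<inter> perp (set ys)"
      using assms by (auto simp: perp_def bilin_diff_left vec.subspace_diff)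
    show "(\<lambda>z. z + z\<^sub>0) ` (K \<inter> perp (set ys)) \<subseteq> {z\<in>K. map (bilin z) ys = vs}"
      using assms by (auto simp: perp_def bilin_add_left vec.subspace_add)
  qed auto
qed

text \<open>Each value of the new pairing is attained on a coset of the smaller space or not at all.
  Equality may fail, for instance when y already lies in the span of S.\<close>

lemma card_perp_insert:
  fixes S :: "('a::{field,finite} ^ ('d::finite + 'd)) set"
  shows "card (perp S) \<le> CARD('a) * card (perp (insert y S))"
proof -
  have perp: "perp (insert y S) = perp S \<inter> perp (set [y])"
    using perp_Un[of "{y}" S] by auto
  have le: "card {z\<in>perp S. map (bilin z) [y] = [v]} \<le> card (perp (insert y S))" for v
  proof (cases "\<exists>z\<^sub>0\<in>perp S. map (bilin z\<^sub>0) [y] = [v]")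
    case True
    then show ?thesis using card_level_set[OF subspace_perp, of _ S "[y]" "[v]"] perp by auto
  next
    case False
    then have "{z\<in>perp S. map (bilin z) [y] = [v]} = {}" by auto
    then show ?thesis by (simp only: card.empty le0)
  qed
  have "card (perp S) = (\<Sum>v\<in>UNIV. card {z\<in>perp S. bilin z y = v})"
    using sum.group[of "perp S" UNIV "\<lambda>z. bilin z y" "\<lambda>_. 1 :: nat"] by simp
  also have "\<dots> \<le> (\<Sum>v\<in>(UNIV :: 'a set). card (perp (insert y S)))"
    using le by (intro sum_mono) simp
  finally show ?thesis by simp
qed

lemma card_perp_Un:
  fixes S :: "('a::{field,finite} ^ ('d::finite + 'd)) set"
  shows "card (perp S) \<le> CARD('a) ^ card T * card (perp (S \<union> T))"
proof -
  have "finite T" by simp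
  then show ?thesis
  proof (induction T)
    case (insert y T)
    have "card (perp (S \<union> T)) \<le> CARD('a) * card (perp (S \<union> insert y T))"
      using card_perp_insert[of "S \<union> T" y] by simp
    then have "CARD('a) ^ card T * card (perp (S \<union> T)) \<le> CARD('a) ^ card (insert y T) * card (perp (S \<union> insert y T))"
      using insert by (simp add: mult_ac mult_left_mono)
    then show ?case using insert by linarith
  qed simp
qed

lemma dim_UNIV_double: "vec.dim (UNIV :: ('a::field ^ ('d::finite + 'd)) set) = 2 * CARD('d)"
  by (simp add: card_UNIV_sum vec.dim_UNIV card_cart_basis)

text \<open>A squeeze by \<open>card_perp_Un\<close>: descending from the whole space to the perp of
  a basis B of S bounds it from below, and descending from there to the perp of a full basis, which
  is 0 by nondegeneracy, bounds it from above.\<close>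

lemma card_perp:
  fixes S :: "('a::{field,finite} ^ ('d::finite + 'd)) set"
  shows "card (perp S) = CARD('a) ^ (2 * CARD('d) - vec.dim S)"
proof -
  have q: "CARD('a) > 1" using card_field_ge_2[where 'a='a] by simp
  obtain B where B: "B \<subseteq> S" "vec.independent B" "S \<subseteq> vec.span B" "card B = vec.dim S"
    using vec.basis_exists[of S] by blast
  obtain C where C: "B \<subseteq> C" "vec.independent C" "UNIV \<subseteq> vec.span C"
    by (rule vec.maximal_independent_subset_extend[of B UNIV]) (use B(2) in auto)
  have cardC: "card C = 2 * CARD('d)"
    using vec.basis_card_eq_dim[OF _ C(3,2)] dim_UNIV_double by simp
  have "vec.span B = vec.span S"
    using vec.span_mono[OF B(1)] vec.span_minimal[OF B(3)] by auto
  then have pS: "perp S = perp B" by (metis perp_span)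
  have "perp C = {0}"
  proof -
    have "perp C = perp (UNIV :: ('a ^ ('d + 'd)) set)" 
      using C(3) perp_span[of C] top.extremum_unique[of "vec.span C"] by simp
    then show ?thesis using bilin_nondegenerate by (auto simp: perp_def)
  qed
  moreover have "card (perp B) \<le> CARD('a) ^ card (C - B) * card (perp (B \<union> (C - B)))"
    by (rule card_perp_Un)
  moreover have "B \<union> (C - B) = C" using C(1) by auto
  moreover have "card (C - B) = 2 * CARD('d) - vec.dim S"
    using C(1) cardC B(4) by (simp add: card_Diff_subset)
  ultimately have le: "card (perp B) \<le> CARD('a) ^ (2 * CARD('d) - vec.dim S)" by simp
  have "perp {} = (UNIV :: ('a ^ ('d + 'd)) set)" by (auto simp: perp_def)
  then have "CARD('a) ^ (2 * CARD('d)) \<le> CARD('a) ^ vec.dim S * card (perp B)"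
    using card_perp_Un[of "{}" B] B(4) card_subspace[of "UNIV :: ('a ^ ('d + 'd)) set"]
    by (simp only: dim_UNIV_double vec.subspace_UNIV Un_empty_left simp_thms)
  moreover have "2 * CARD('d) = vec.dim S + (2 * CARD('d) - vec.dim S)"
    using vec.dim_subset[of S UNIV] dim_UNIV_double[where 'a='a and 'd='d] by simp
  ultimately have "CARD('a) ^ vec.dim S * CARD('a) ^ (2 * CARD('d) - vec.dim S) \<le> CARD('a) ^ vec.dim S * card (perp B)"
    by (metis power_add)
  then have "CARD('a) ^ (2 * CARD('d) - vec.dim S) \<le> card (perp B)" using q by simp
  then show ?thesis using le pS by simp
qed

lemma isotropic_subset: "isotropic V \<Longrightarrow> vec.subspace W \<Longrightarrow> W \<subseteq> V \<Longrightarrow> isotropic W"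
  by (auto simp: isotropic_def)

lemma isotropic_bilin:
  assumes "isotropic V" "x \<in> V" "y \<in> V"
  shows "bilin x y = 0"
proof -
  have "x + y \<in> V" using assms vec.subspace_add by (auto simp: isotropic_def)
  then show ?thesis using assms hyp_form_add[of x y] by (auto simp: isotropic_def)
qed

lemma isotropic_span_insert:
  "isotropic (vec.span (insert x S)) \<longleftrightarrow> isotropic (vec.span S) \<and> hyp_form x = 0 \<and> x \<in> perp S"
proof
  assume iso: "isotropic (vec.span (insert x S))"
  have "vec.span S \<subseteq> vec.span (insert x S)" "insert x S \<subseteq> vec.span (insert x S)"
    using vec.span_mono[of S "insert x S"] vec.span_superset[of "insert x S"] by auto
  then show "isotropic (vec.span S) \<and> hyp_form x = 0 \<and> x \<in> perp S"
    using isotropic_subset[OF iso] isotropic_bilin[OF iso] iso by (auto simp: isotropic_def perp_def)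
next
  assume *: "isotropic (vec.span S) \<and> hyp_form x = 0 \<and> x \<in> perp S"
  have "hyp_form v = 0" if v: "v \<in> vec.span (insert x S)" for v
  proof -
    obtain k where k: "v - k *s x \<in> vec.span S" using v unfolding vec.span_insert by blast
    then have "bilin x (v - k *s x) = 0" using * perp_span[of S] by (auto simp: perp_def)
    then show ?thesis
      using hyp_form_add[of "k *s x" "v - k *s x"] * k by (auto simp: hyp_form_scale bilin_scale_left isotropic_def)
  qed
  then show "isotropic (vec.span (insert x S))" by (simp add: isotropic_def)
qed

text \<open>V lies in its own perp, whose size is known from \<open>card_perp\<close>.\<close>

lemma dim_isotropic_le:
  fixes V :: "('a::{field,finite} ^ ('d::finite + 'd)) set"
  assumes "isotropic V"
  shows "vec.dim V \<le> CARD('d)"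
proof -
  have q: "CARD('a) > 1" using card_field_ge_2[where 'a='a] by simp
  have "V \<subseteq> perp V" using isotropic_bilin[OF assms] by (auto simp: perp_def)
  then have "card V \<le> card (perp V)" by (intro card_mono) auto
  then have "vec.dim V \<le> 2 * CARD('d) - vec.dim V"
    using card_perp[of V] card_subspace[of V] assms q by (simp add: isotropic_def)
  then show ?thesis by linarith
qed

section \<open>Frames: isotropic lists independent modulo I\<close>

text \<open>A frame lifts a basis of V modulo V \<inter> I. Asking for independence modulo I itself
  allows it to be built before V is known.\<close>

definition frame :: "('a::field ^ ('d::finite + 'd)) set \<Rightarrow> ('a ^ ('d + 'd)) list \<Rightarrow> bool" where
  "frame I xs \<longleftrightarrow> indep_mod I xs \<and> isotropic (vec.span (set xs))"

context
  fixes I :: "('a::{field,finite} ^ ('d::finite + 'd)) set" and d :: nat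
  assumes I: "isotropic I" "vec.dim I = d" and d: "CARD('d) = d"
begin

lemma perp_max: "perp I = I"
proof (rule card_subset_eq[symmetric])
  show "I \<subseteq> perp I" using isotropic_bilin[OF I(1)] by (auto simp: perp_def)
  show "card I = card (perp I)"
    using card_perp[of I] card_subspace[of I] I d by (simp add: isotropic_def)
qed simp

lemma card_max_perp:
  assumes "indep_mod I ys"
  shows "card (I \<inter> perp (set ys)) = CARD('a) ^ (d - length ys)" "length ys \<le> d"
proof -
  have "I \<inter> perp (set ys) = perp (I \<union> set ys)" by (simp add: perp_Un perp_max)
  then show "card (I \<inter> perp (set ys)) = CARD('a) ^ (d - length ys)"
    using card_perp[of "I \<union> set ys"] dim_indep_mod[OF assms] I d by simp
  show "length ys \<le> d"
    using vec.dim_subset[of "I \<union> set ys" UNIV] dim_indep_mod[OF assms] I d dim_UNIV_double[where 'a='a and 'd='d] by simp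
qed

lemma dim_max_perp:
  assumes "indep_mod I ys"
  shows "vec.subspace (I \<inter> perp (set ys))" "vec.dim (I \<inter> perp (set ys)) = d - length ys"
proof -
  show s: "vec.subspace (I \<inter> perp (set ys))"
    using I subspace_perp by (intro vec.subspace_inter) (auto simp: isotropic_def)
  show "vec.dim (I \<inter> perp (set ys)) = d - length ys"
    using card_max_perp(1)[OF assms] card_subspace[OF s] card_field_ge_2[where 'a='a] by simp
qed

text \<open>The nonempty fibres of the pairing map on I all have q^(d - length ys) elements, so its
  image has q^(length ys) elements and every prescribed list of values occurs.\<close>

lemma card_max_level_set:
  assumes "indep_mod I ys" "length vs = length ys"
  shows "card {z\<in>I. map (bilin z) ys = vs} = CARD('a) ^ (d - length ys)"
proof -
  let ?f = "\<lambda>z. map (bilin z) ys"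
  have subI: "vec.subspace I" using I by (simp add: isotropic_def)
  have fib: "card {z\<in>I. ?f z = vs} = CARD('a) ^ (d - length ys)" if "vs \<in> ?f ` I" for vs
    using that card_level_set[OF subI, of _ ys vs] card_max_perp(1)[OF assms(1)] by auto
  have "card I = card (?f ` I) * CARD('a) ^ (d - length ys)"
    by (rule card_fibres[OF _ _ _ fib]) auto
  moreover have "card I = CARD('a) ^ length ys * CARD('a) ^ (d - length ys)"
    using card_subspace[OF subI] I(2) card_max_perp(2)[OF assms(1)] by (simp flip: power_add)
  ultimately have "card (?f ` I) = CARD('a) ^ length ys" by simp
  moreover have "card {vs :: 'a list. set vs \<subseteq> UNIV \<and> length vs = length ys} = CARD('a) ^ length ys"
    by (rule card_lists_length_eq) simp
  ultimately have "?f ` I = {vs. set vs \<subseteq> UNIV \<and> length vs = length ys}"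
    by (intro card_subset_eq finite_lists_length_eq) auto
  then show ?thesis using fib[of vs] assms(2) by blast
qed

text \<open>Count pairs (x, z), with x outside the span of I and xs and z in I, for which x + z
  extends the frame, once by x and once by x + z. For fixed x, isotropy of x + z says
  \<open>bilin z x\<close> = - \<open>hyp_form x\<close>; with orthogonality to xs this makes length
  xs + 1 independent affine conditions on z.\<close>

lemma card_frame_extend:
  assumes "frame I xs"
  shows "card {x. frame I (x # xs)} = (CARD('a) ^ d - CARD('a) ^ length xs) * CARD('a) ^ (d - length xs - 1)"
proof -
  let ?i = "length xs"
  let ?S = "vec.span (I \<union> set xs)"
  let ?G = "{x. frame I (x # xs)}"
  let ?T = "{(x, z). x \<notin> ?S \<and> z \<in> I \<and> x + z \<in> ?G}"
  have subI: "vec.subspace I" using I by (simp add: isotropic_def)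
  have xs: "indep_mod I xs" "isotropic (vec.span (set xs))" using assms by (auto simp: frame_def)
  have G: "frame I (x # xs) \<longleftrightarrow> x \<notin> ?S \<and> hyp_form x = 0 \<and> x \<in> perp (set xs)" for x
    using xs by (auto simp: frame_def isotropic_span_insert)
  have IS: "z \<in> ?S" if "z \<in> I" for z using that by (auto intro: vec.span_base)
  have addS: "x + z \<in> ?S \<longleftrightarrow> x \<in> ?S" if "z \<in> I" for x z
    using IS[OF that] by (metis add_diff_cancel_right' vec.span_add vec.span_diff)
  have "card ?T = card (- ?S) * CARD('a) ^ (d - ?i - 1)"
  proof (rule card_fibres[of _ _ fst])
    fix x assume x: "x \<in> - ?S"
    have ind: "indep_mod I (x # xs)" using x xs by simp
    have "x + z \<in> ?G \<longleftrightarrow> map (bilin z) (x # xs) = - hyp_form x # map (\<lambda>y. - bilin x y) xs" if z: "z \<in> I" for z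
    proof -
      have "hyp_form z = 0" using z I by (auto simp: isotropic_def)
      then have "hyp_form (x + z) = 0 \<longleftrightarrow> bilin z x = - hyp_form x"
        by (simp add: hyp_form_add bilin_sym[of x] eq_neg_iff_add_eq_0 add.commute)
      moreover have "x + z \<in> perp (set xs) \<longleftrightarrow> map (bilin z) xs = map (\<lambda>y. - bilin x y) xs"
        by (simp add: perp_def bilin_add_left eq_neg_iff_add_eq_0 add.commute)
      ultimately show ?thesis using x addS[OF z] by (simp add: G)
    qed
    then have "{p\<in>?T. fst p = x} = Pair x ` {z\<in>I. map (bilin z) (x # xs) = - hyp_form x # map (\<lambda>y. - bilin x y) xs}"
      using x by auto
    then show "card {p\<in>?T. fst p = x} = CARD('a) ^ (d - ?i - 1)"
      using card_max_level_set[OF ind, of "- hyp_form x # map (\<lambda>y. - bilin x y) xs"]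
      by (simp add: card_image inj_on_def)
  qed auto
  \<comment> \<open>Each g arises from exactly the pairs (g - z, z) with z in I.\<close>
  moreover have "card ?T = card ?G * CARD('a) ^ d"
  proof (rule card_fibres[of _ _ "\<lambda>(x, z). x + z"])
    fix g assume g: "g \<in> ?G"
    have "g - z \<notin> ?S" if "z \<in> I" for z using addS[OF that, of "g - z"] g by (simp add: G)
    then have "{p\<in>?T. (\<lambda>(x, z). x + z) p = g} = (\<lambda>z. (g - z, z)) ` I"
      using g by (auto simp: image_iff)
    then show "card {p\<in>?T. (\<lambda>(x, z). x + z) p = g} = CARD('a) ^ d"
      using card_subspace[OF subI] I by (simp add: card_image inj_on_def)
  qed auto
  moreover have "card (- ?S) = CARD('a) ^ d * (CARD('a) ^ d - CARD('a) ^ ?i)"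
  proof -
    have "card (- ?S) = card (UNIV :: ('a ^ ('d + 'd)) set) - card ?S" 
      by (simp add: Compl_eq_Diff_UNIV card_Diff_subset)
    also have "card (UNIV :: ('a ^ ('d + 'd)) set) = CARD('a) ^ (2 * d)"
      using card_subspace[of "UNIV :: ('a ^ ('d + 'd)) set"] by (simp only: dim_UNIV_double vec.subspace_UNIV d simp_thms)
    also have "card ?S = CARD('a) ^ (d + ?i)" using card_span[of "I \<union> set xs"] dim_indep_mod[OF xs(1)] I by simp
    finally show ?thesis by (simp add: power_add diff_mult_distrib2 mult_2)
  qed
  ultimately have "card ?G * CARD('a) ^ d = ((CARD('a) ^ d - CARD('a) ^ ?i) * CARD('a) ^ (d - ?i - 1)) * CARD('a) ^ d"
    by (simp add: mult_ac)
  then show ?thesis by simp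
qed

lemma card_frames:
  "card {xs. frame I xs \<and> length xs = m} = (\<Prod>i<m. (CARD('a) ^ d - CARD('a) ^ i) * CARD('a) ^ (d - i - 1))"
proof (rule card_lists_extend)
  show "frame I []" by (simp add: frame_def isotropic_def hyp_form_def hyp_plane_form_def)
  show "frame I (x # xs) \<Longrightarrow> frame I xs" for x xs by (auto simp: frame_def isotropic_span_insert)
qed (rule card_frame_extend)

end

section \<open>Isotropic subspaces by their intersection with I\<close>

definition iso_subspaces :: "('a::field ^ ('d::finite + 'd)) set \<Rightarrow> nat \<Rightarrow> nat \<Rightarrow> ('a ^ ('d + 'd)) set set" where
  "iso_subspaces I p m = {V. isotropic V \<and> vec.dim (V \<inter> I) = p \<and> vec.dim V = p + m}"

context
  fixes I :: "('a::{field,finite} ^ ('d::finite + 'd)) set" and d :: nat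
  assumes I: "isotropic I" "vec.dim I = d" and d: "CARD('d) = d"
begin

text \<open>Let V be the span. Being independent modulo I, xs is independent modulo V \<inter> I, so
  dim V = dim (V \<inter> I) + length xs, which leaves no room for V \<inter> I beyond U.\<close>

lemma iso_subspace_of_frame:
  assumes "frame I xs" "vec.subspace U" "U \<subseteq> I \<inter> perp (set xs)"
  shows "isotropic (vec.span (U \<union> set xs))" "vec.dim (U \<union> set xs) = vec.dim U + length xs"
    "vec.span (U \<union> set xs) \<inter> I = U"
proof -
  let ?V = "vec.span (U \<union> set xs)"
  have xs: "indep_mod I xs" "isotropic (vec.span (set xs))" using assms by (auto simp: frame_def)
  have subI: "vec.subspace I" using I by (simp add: isotropic_def)
  show "isotropic ?V"
  proof -
    have "hyp_form v = 0" if vV: "v \<in> ?V" for v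
    proof -
      obtain u w where v: "v = u + w" "u \<in> vec.span U" "w \<in> vec.span (set xs)"
        using vV unfolding vec.span_Un by auto
      then have u: "u \<in> U" using assms(2) by (simp add: vec.span_eq_iff[THEN iffD2])
      then have "u \<in> perp (vec.span (set xs))" using assms(3) perp_span by blast
      then have "bilin u w = 0" using v by (auto simp: perp_def)
      moreover have "hyp_form u = 0" "hyp_form w = 0" using u v I xs assms(3) by (auto simp: isotropic_def)
      ultimately show ?thesis using v by (simp add: hyp_form_add)
    qed
    then show ?thesis by (simp add: isotropic_def)
  qed
  show dimV: "vec.dim (U \<union> set xs) = vec.dim U + length xs"
    using indep_mod_mono[OF xs(1), of U] assms(3) by (intro dim_indep_mod) auto
  have sub: "vec.subspace (?V \<inter> I)" using subI by (simp add: vec.subspace_inter)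
  have UV: "U \<subseteq> ?V \<inter> I" using assms(3) vec.span_superset[of "U \<union> set xs"] by auto
  have "vec.span (?V \<inter> I \<union> set xs) = ?V"
  proof
    show "vec.span (?V \<inter> I \<union> set xs) \<subseteq> ?V"
      using vec.span_superset[of "U \<union> set xs"] by (intro vec.span_minimal) auto
    show "?V \<subseteq> vec.span (?V \<inter> I \<union> set xs)" using UV by (intro vec.span_mono) auto
  qed
  moreover have "vec.dim (?V \<inter> I \<union> set xs) = vec.dim (?V \<inter> I) + length xs"
    using indep_mod_mono[OF xs(1), of "?V \<inter> I"] by (intro dim_indep_mod) auto
  ultimately have "vec.dim (?V \<inter> I) = vec.dim U"
    using dimV vec.dim_span[of "?V \<inter> I \<union> set xs"] vec.dim_span[of "U \<union> set xs"] by simp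
  then show "?V \<inter> I = U"
    using vec.subspace_dim_equal[OF assms(2) sub UV] by simp
qed

text \<open>In a dependency x = u + w with u in I and w in the span of xs, both x and w lie in V,
  hence u lies in V \<inter> I.\<close>

lemma frame_of_iso_subspace:
  assumes "isotropic V" "set xs \<subseteq> V" "indep_mod (V \<inter> I) xs"
  shows "frame I xs" "V \<inter> I \<subseteq> I \<inter> perp (set xs)"
proof -
  have subV: "vec.subspace V" using assms by (simp add: isotropic_def)
  have "indep_mod I xs" using assms(2,3)
  proof (induction xs)
    case (Cons x xs)
    have "x \<notin> vec.span (I \<union> set xs)"
    proof
      assume "x \<in> vec.span (I \<union> set xs)"
      then obtain u w where x: "x = u + w" "u \<in> vec.span I" "w \<in> vec.span (set xs)"
        unfolding vec.span_Un by auto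
      have w: "w \<in> V" using vec.span_minimal[of "set xs" V] x Cons.prems subV by auto
      have "u \<in> V" using vec.subspace_diff[OF subV _ w, of x] x Cons.prems by simp
      moreover have "u \<in> I" using x(2) I(1) vec.span_minimal[of I I] by (auto simp: isotropic_def)
      ultimately have "u \<in> vec.span (V \<inter> I)" by (simp add: vec.span_base)
      then have "x \<in> vec.span (V \<inter> I \<union> set xs)"
        unfolding vec.span_Un using x by blast
      then show False using Cons.prems by simp
    qed
    then show ?case using Cons by simp
  qed simp
  moreover have "isotropic (vec.span (set xs))"
    using isotropic_subset[OF assms(1)] vec.span_minimal[OF assms(2) subV] by simp
  ultimately show "frame I xs" by (simp add: frame_def)
  show "V \<inter> I \<subseteq> I \<inter> perp (set xs)"
    using isotropic_bilin[OF assms(1)] assms(2) by (auto simp: perp_def)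
qed

text \<open>Double counting: (xs, U) corresponds to (V, xs) by V = span (U \<union> xs) and U = V
  \<inter> I. A frame xs restricts U to the space I \<inter> perp xs of dimension d - m.\<close>

lemma card_iso_subspaces:
  assumes "p + m \<le> d"
  shows "of_nat (card (iso_subspaces I p m) * (\<Prod>i<m. CARD('a) ^ (p + m) - CARD('a) ^ (p + i)))
      = of_nat (\<Prod>i<m. (CARD('a) ^ d - CARD('a) ^ i) * CARD('a) ^ (d - i - 1)) * signs_gf (of_nat CARD('a)) (d - m - p) p 0"
proof -
  have fin: "finite {xs. P xs \<and> length xs = m}" for P :: "('a ^ ('d + 'd)) list \<Rightarrow> bool"
    by (rule finite_subset[OF _ finite_lists_length_eq[of UNIV m]]) auto
  define q :: rat where "q = of_nat CARD('a)"
  let ?U = "\<lambda>W. {U. vec.subspace U \<and> U \<subseteq> W \<and> vec.dim U = p}"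
  have U: "of_nat (card (?U W)) = signs_gf q (d - m - p) p 0"
    if "vec.subspace W" "vec.dim W = d - m" for W :: "('a ^ ('d + 'd)) set"
    using card_subspaces_signs_gf[OF that(1), of p q] that(2) assms by (simp add: q_def)
  \<comment> \<open>Any space of dimension d - m will do: \<open>W\<close> only names the number of
    choices for U as a natural number, since \<open>signs_gf\<close> is rational.\<close>
  obtain W :: "('a ^ ('d + 'd)) set" where W: "vec.subspace W" "vec.dim W = d - m"
    using vec.choose_subspace_of_subspace[of "d - m" I] I by auto
  define N where "N = card (?U W)"
  have N: "of_nat N = signs_gf q (d - m - p) p 0" using U[OF W] by (simp add: N_def)
  let ?F = "{xs. frame I xs \<and> length xs = m}"
  let ?L = "\<lambda>V. {xs. (indep_mod (V \<inter> I) xs \<and> set xs \<subseteq> V) \<and> length xs = m}"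
  let ?A = "SIGMA xs:?F. ?U (I \<inter> perp (set xs))"
  let ?B = "SIGMA V:iso_subspaces I p m. ?L V"
  have "card ?A = card ?F * N"
  proof -
    have "card (?U (I \<inter> perp (set xs))) = N" if "xs \<in> ?F" for xs
    proof -
      have "indep_mod I xs" using that by (simp add: frame_def)
      then have "rat_of_nat (card (?U (I \<inter> perp (set xs)))) = of_nat N"
        unfolding N using dim_max_perp[OF I d, of xs] that by (intro U) auto
      then show ?thesis by (simp only: of_nat_eq_iff)
    qed
    then show ?thesis using fin[of "frame I"] by (simp add: card_SigmaI)
  qed
  moreover have "card ?B = card (iso_subspaces I p m) * (\<Prod>i<m. CARD('a) ^ (p + m) - CARD('a) ^ (p + i))"
  proof -
    have "card (?L V) = (\<Prod>i<m. CARD('a) ^ (p + m) - CARD('a) ^ (p + i))" if "V \<in> iso_subspaces I p m" for V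
      using card_indep_mod[of V "V \<inter> I" m] that by (simp add: iso_subspaces_def isotropic_def)
    then show ?thesis using fin by (simp add: card_SigmaI)
  qed
  moreover have "bij_betw (\<lambda>(xs, U). (vec.span (U \<union> set xs), xs)) ?A ?B"
  proof (rule bij_betw_byWitness[of _ "\<lambda>(V, xs). (xs, V \<inter> I)"])
    show "\<forall>a\<in>?A. (\<lambda>(V, xs). (xs, V \<inter> I)) ((\<lambda>(xs, U). (vec.span (U \<union> set xs), xs)) a) = a"
    proof
      fix a assume "a \<in> ?A"
      then obtain xs U where "a = (xs, U)" "frame I xs" "vec.subspace U" "U \<subseteq> I \<inter> perp (set xs)" by auto
      then show "(\<lambda>(V, xs). (xs, V \<inter> I)) ((\<lambda>(xs, U). (vec.span (U \<union> set xs), xs)) a) = a"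
        using iso_subspace_of_frame(3) by simp
    qed
    show "\<forall>b\<in>?B. (\<lambda>(xs, U). (vec.span (U \<union> set xs), xs)) ((\<lambda>(V, xs). (xs, V \<inter> I)) b) = b"
    proof
      fix b assume "b \<in> ?B"
      then obtain V xs where b: "b = (V, xs)" and *: "indep_mod (V \<inter> I) xs" "set xs \<subseteq> V"
        "V \<in> iso_subspaces I p (length xs)" by auto
      have V: "vec.subspace V" using * by (simp add: iso_subspaces_def isotropic_def)
      have "vec.span (V \<inter> I \<union> set xs) = V"
      proof (rule vec.subspace_dim_equal)
        show "vec.span (V \<inter> I \<union> set xs) \<subseteq> V" using * V by (intro vec.span_minimal) auto
        show "vec.dim V \<le> vec.dim (vec.span (V \<inter> I \<union> set xs))"
          using dim_indep_mod[OF *(1)] *(3) by (simp add: iso_subspaces_def)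
      qed (use V in auto)
      then show "(\<lambda>(xs, U). (vec.span (U \<union> set xs), xs)) ((\<lambda>(V, xs). (xs, V \<inter> I)) b) = b"
        using b by simp
    qed
    show "(\<lambda>(xs, U). (vec.span (U \<union> set xs), xs)) ` ?A \<subseteq> ?B"
    proof (rule image_subsetI)
      fix a assume "a \<in> ?A"
      then obtain xs U where a: "a = (xs, U)" and *: "frame I xs" "vec.subspace U" "U \<subseteq> I \<inter> perp (set xs)"
        "m = length xs" "p = vec.dim U" by auto
      let ?V = "vec.span (U \<union> set xs)"
      have "?V \<inter> I = U" "?V \<in> iso_subspaces I p m"
        using iso_subspace_of_frame[OF *(1-3)] *(4,5) by (simp_all add: iso_subspaces_def)
      moreover have "indep_mod U xs" using * indep_mod_mono[of I xs U] by (auto simp: frame_def)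
      moreover have "set xs \<subseteq> ?V" using vec.span_superset[of "U \<union> set xs"] by simp
      ultimately show "(\<lambda>(xs, U). (vec.span (U \<union> set xs), xs)) a \<in> ?B"
        using a *(4) by simp
    qed
    show "(\<lambda>(V, xs). (xs, V \<inter> I)) ` ?B \<subseteq> ?A"
    proof (rule image_subsetI)
      fix b assume "b \<in> ?B"
      then obtain V xs where b: "b = (V, xs)" and *: "indep_mod (V \<inter> I) xs" "set xs \<subseteq> V" "m = length xs"
        "V \<in> iso_subspaces I p (length xs)" by auto
      then have V: "isotropic V" "vec.dim (V \<inter> I) = p" by (auto simp: iso_subspaces_def)
      then have "vec.subspace (V \<inter> I)" using I by (simp add: isotropic_def vec.subspace_inter)
      then show "(\<lambda>(V, xs). (xs, V \<inter> I)) b \<in> ?A"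
        using frame_of_iso_subspace[OF V(1) *(2,1)] V b *(3) by simp
    qed
  qed
  ultimately have "card (iso_subspaces I p m) * (\<Prod>i<m. CARD('a) ^ (p + m) - CARD('a) ^ (p + i))
      = (\<Prod>i<m. (CARD('a) ^ d - CARD('a) ^ i) * CARD('a) ^ (d - i - 1)) * N"
    using card_frames[OF I d, of m] by (auto dest: bij_betw_same_card)
  then show ?thesis unfolding q_def[symmetric] N[symmetric] of_nat_mult[symmetric] by (rule arg_cong)
qed

lemma sum_descending: "m \<le> d \<Longrightarrow> (\<Sum>i<m. d - i - 1) = m * (d - m) + (m choose 2)"
proof (induction m)
  case (Suc m)
  then have "d - m = Suc (d - Suc m)" by simp
  then show ?case using Suc by (simp add: numeral_2_eq_2)
qed (simp add: numeral_2_eq_2)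

lemma card_iso_subspaces_signs_gf:
  assumes "p + m \<le> d"
  shows "of_nat (card (iso_subspaces I p m)) = signs_gf (of_nat CARD('a)) (d - (p + m)) p m"
proof -
  define q :: rat where "q = of_nat CARD('a)"
  define z where "z = d - (p + m)"
  have dz: "d = z + p + m" "d - m - p = z" "d - m = z + p" "m \<le> d" using assms by (auto simp: z_def)
  let ?c = "m choose 2"
  let ?C = "of_nat (card (iso_subspaces I p m)) :: rat"
  have Q: "CARD('a) \<ge> 1" "q > 1" using card_field_ge_2[where 'a='a] by (auto simp: q_def)
  then have nz: "qfact q n \<noteq> 0" "q \<noteq> 0" for n using qfact_nonzero by auto
  \<comment> \<open>The separated power q^(p m) cancels the p-part of m (d - m) = m (z + p) on the
    frame side.\<close>
  have "(\<Prod>i<m. CARD('a) ^ (p + m) - CARD('a) ^ (p + i)) = CARD('a) ^ (p * m) * (\<Prod>i<m. CARD('a) ^ m - CARD('a) ^ i)"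
    by (simp add: power_add diff_mult_distrib2[symmetric] prod.distrib power_mult)
  moreover have "of_nat (\<Prod>i<m. CARD('a) ^ m - CARD('a) ^ i) = q ^ ?c * qfact q m"
    using prod_qfact[of m m, OF _ Q(1)] by (simp add: q_def)
  ultimately have 1: "of_nat (\<Prod>i<m. CARD('a) ^ (p + m) - CARD('a) ^ (p + i)) = q ^ (p * m) * (q ^ ?c * qfact q m)"
    by (simp only: of_nat_mult of_nat_power q_def[symmetric])
  have "(\<Prod>i<m. (CARD('a) ^ d - CARD('a) ^ i) * CARD('a) ^ (d - i - 1))
      = (\<Prod>i<m. CARD('a) ^ d - CARD('a) ^ i) * CARD('a) ^ (m * (d - m) + ?c)"
    by (simp only: prod.distrib power_sum[symmetric] sum_descending[OF dz(4)])
  then have "of_nat (\<Prod>i<m. (CARD('a) ^ d - CARD('a) ^ i) * CARD('a) ^ (d - i - 1)) * qfact q (z + p)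
      = of_nat (\<Prod>i<m. CARD('a) ^ d - CARD('a) ^ i) * qfact q (z + p) * q ^ (m * (z + p) + ?c)"
    unfolding dz(3) by (simp only: of_nat_mult of_nat_power q_def[symmetric] mult_ac)
  then have 2: "of_nat (\<Prod>i<m. (CARD('a) ^ d - CARD('a) ^ i) * CARD('a) ^ (d - i - 1)) * qfact q (z + p)
      = q ^ ?c * qfact q d * q ^ (m * (z + p) + ?c)"
    using prod_qfact[OF dz(4) Q(1)] unfolding dz(3) q_def[symmetric] by (simp only:)
  have 3: "signs_gf q z p 0 * (qfact q z * qfact q p) = qfact q (z + p)"
    using signs_gf_qfact[of q z p 0] by (simp add: numeral_2_eq_2)
  have 4: "signs_gf q z p m * (qfact q z * qfact q p * qfact q m) = qfact q d * q ^ (?c + m * z)"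
    using signs_gf_qfact[of q z p m] dz(1) by simp
  let ?P = "of_nat (\<Prod>i<m. (CARD('a) ^ d - CARD('a) ^ i) * CARD('a) ^ (d - i - 1)) :: rat"
  let ?K = "q ^ (p * m) * q ^ ?c * qfact q m * (qfact q z * qfact q p)"
  have "?C * ?K = ?C * (q ^ (p * m) * (q ^ ?c * qfact q m)) * (qfact q z * qfact q p)" by simp
  also have "\<dots> = ?P * (signs_gf q z p 0 * (qfact q z * qfact q p))"
    using card_iso_subspaces[OF assms] unfolding dz(2) of_nat_mult 1 q_def[symmetric] by simp
  also have "\<dots> = q ^ ?c * qfact q d * q ^ (m * (z + p) + ?c)" unfolding 3 2 ..
  also have "\<dots> = (qfact q d * q ^ (?c + m * z)) * (q ^ (p * m) * q ^ ?c)"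
    by (simp add: power_add distrib_left mult_ac)
  also have "\<dots> = signs_gf q z p m * ?K" unfolding 4[symmetric] by simp
  finally have "?C * ?K = signs_gf q z p m * ?K" .
  then show ?thesis using nz by (simp add: q_def z_def)
qed

end

section \<open>Weighted flags\<close>

definition weighted_flag :: "(('a::field ^ ('d::finite + 'd)) set \<times> nat) list \<Rightarrow> bool" where
  "weighted_flag F \<longleftrightarrow> flag (map fst F) \<and> (\<forall>w\<in>set (map snd F). w > 0)"

text \<open>With top {0} for the empty flag, every weighted flag has an isotropic top and one parity
  condition covers all even flags.\<close>

definition top_space :: "(('a::field ^ ('d::finite + 'd)) set \<times> nat) list \<Rightarrow> ('a ^ ('d + 'd)) set" where
  "top_space F = (if F = [] then {0} else fst (last F))"

lemma top_space_simps [simp]: "top_space [] = {0}" "top_space (F @ [(V, w)]) = V"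
  by (simp_all add: top_space_def)

lemma weighted_even_flags_eq:
  "weighted_even_flags I = {F. weighted_flag F \<and> even (vec.dim (top_space F) - vec.dim (top_space F \<inter> I))}"
proof -
  have "even_flag I (map fst F) \<longleftrightarrow> flag (map fst F) \<and> even (vec.dim (top_space F) - vec.dim (top_space F \<inter> I))" for F
    by (cases "F = []") (auto simp: even_flag_def top_space_def last_map)
  then show ?thesis by (auto simp: weighted_even_flags_def weighted_flag_def)
qed

lemma isotropic_top_space: "weighted_flag F \<Longrightarrow> isotropic (top_space F)"
  by (cases F rule: rev_cases)
    (auto simp: weighted_flag_def flag_def top_space_def isotropic_def hyp_form_def hyp_plane_form_def vec.subspace_def)

lemma top_space_eq_zero: "weighted_flag F \<Longrightarrow> top_space F = {0} \<longleftrightarrow> F = []"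
  by (cases F rule: rev_cases) (auto simp: weighted_flag_def flag_def top_space_def)

lemma weighted_flag_Nil [simp]: "weighted_flag []"
  by (simp add: weighted_flag_def flag_def)

lemma weighted_flag_snoc:
  "weighted_flag (F @ [(V, w)]) \<longleftrightarrow> weighted_flag F \<and> isotropic V \<and> top_space F \<subset> V \<and> w > 0"
proof (cases F rule: rev_cases)
  case Nil
  then show ?thesis
    by (auto simp: weighted_flag_def flag_def isotropic_def dest: vec.subspace_0)
next
  case (snoc G p)
  obtain W u where p: "p = (W, u)" by (cases p)
  have "(\<forall>x\<in>set G. fst x \<subset> W) \<Longrightarrow> W \<subset> V \<Longrightarrow> \<forall>x\<in>set G. fst x \<subset> V"
    using psubset_trans by blast
  moreover have "isotropic W \<Longrightarrow> W \<subset> V \<Longrightarrow> V \<noteq> {0}"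
    using vec.subspace_0[of W] by (auto simp: isotropic_def)
  ultimately show ?thesis
    unfolding snoc p by (simp add: weighted_flag_def flag_def sorted_wrt_append ball_Un) blast
qed

lemma flag_weight_snoc [simp]: "flag_weight (F @ [(V, w)]) = flag_weight F + w * vec.dim V"
  by (simp add: flag_weight_def)

lemma flag_weight_Nil [simp]: "flag_weight [] = 0"
  by (simp add: flag_weight_def)

lemma dim_isotropic_pos: "isotropic V \<Longrightarrow> V \<noteq> {0} \<Longrightarrow> vec.dim V > 0"
  using vec.dim_eq_0[of V] vec.subspace_0[of V] by (auto simp: isotropic_def)

text \<open>Every space in a flag has dimension at least 1, so the total weight bounds both the
  length and each single weight.\<close>

lemma finite_fibres_weighted_flags:
  "finite_fibres {F :: (('a::{field,finite} ^ ('d::finite + 'd)) set \<times> nat) list. weighted_flag F} flag_weight"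
  unfolding finite_fibres_def
proof
  fix n
  have *: "weighted_flag F \<Longrightarrow> length F \<le> flag_weight F \<and> (\<forall>p\<in>set F. snd p \<le> flag_weight F)"
    for F :: "(('a ^ ('d + 'd)) set \<times> nat) list"
  proof (induction F rule: rev_induct)
    case (snoc p F)
    obtain V w where p: "p = (V, w)" by (cases p)
    have F: "weighted_flag F" "isotropic V" "top_space F \<subset> V" "w > 0"
      using snoc.prems unfolding p weighted_flag_snoc by auto
    have "0 \<in> top_space F" using isotropic_top_space[OF F(1)] vec.subspace_0 by (auto simp: isotropic_def)
    then have "V \<noteq> {0}" using F(3) by auto
    define k where "k = w * vec.dim V"
    have "w \<le> k" using \<open>V \<noteq> {0}\<close> dim_isotropic_pos[OF F(2)] by (simp add: k_def)
    moreover have "flag_weight (F @ [p]) = flag_weight F + k" by (simp add: p k_def)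
    ultimately show ?case using snoc.IH[OF F(1)] F(4) p by (auto intro: trans_le_add1)
  qed simp
  have "{F\<in>{F. weighted_flag F}. flag_weight F = n}
      \<subseteq> {F :: (('a ^ ('d + 'd)) set \<times> nat) list. set F \<subseteq> UNIV \<times> {..n} \<and> length F \<le> n}"
  proof clarsimp
    fix F :: "(('a ^ ('d + 'd)) set \<times> nat) list"
    assume "weighted_flag F"
    then show "set F \<subseteq> UNIV \<times> {..flag_weight F} \<and> length F \<le> flag_weight F"
      using *[of F] by auto
  qed
  then show "finite {F \<in> {F :: (('a ^ ('d + 'd)) set \<times> nat) list. weighted_flag F}. flag_weight F = n}"
    by (rule finite_subset) (simp add: finite_lists_length_le)
qed

text \<open>Lowering the weight of the top subspace \<open>V\<close> by one, and dropping \<open>V\<close> when its weight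
  vanishes, turns the flags with top \<open>V\<close> into all flags inside \<open>V\<close>.\<close>

lemma gf_fixed_top:
  fixes V :: "('a::{field,finite} ^ ('d::finite + 'd)) set"
  assumes V: "isotropic V"
  shows "gf {F. weighted_flag F \<and> top_space F = V} flag_weight (\<lambda>_. 1)
    = fps_X ^ vec.dim V * gf {F. weighted_flag F \<and> top_space F \<subseteq> V} flag_weight (\<lambda>_. 1)"
proof (cases "V = {0}")
  case True
  have "{F. weighted_flag F \<and> top_space F \<subseteq> V} = {F. weighted_flag F \<and> top_space F = V}"
    using True isotropic_top_space vec.subspace_0 by (fastforce simp: isotropic_def)
  then show ?thesis using True by simp
next
  case False
  have V0: "{0} \<subset> V" using False V vec.subspace_0 by (auto simp: isotropic_def)
  let ?h = "\<lambda>F. if top_space F = V then butlast F @ [(V, Suc (snd (last F)))] else F @ [(V, 1)]"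
  let ?g = "\<lambda>F. if snd (last F) = 1 then butlast F else butlast F @ [(V, snd (last F) - 1)]"
  let ?B = "{F. weighted_flag F \<and> top_space F \<subseteq> V}"
  let ?T = "{F. weighted_flag F \<and> top_space F = V}"
  have snocT: "\<exists>G w. F = G @ [(V, w)] \<and> weighted_flag G \<and> top_space G \<subset> V \<and> w > 0" if F: "F \<in> ?T" for F
  proof (cases F rule: rev_cases)
    case (snoc G p)
    then show ?thesis using F by (cases p) (auto simp: weighted_flag_snoc)
  qed (use F False in auto)
  have "gf ?B (\<lambda>F. vec.dim V + flag_weight F) (\<lambda>_. 1) = gf ?T flag_weight (\<lambda>_. 1)"
  proof (rule gf_bij_betw)
    show "bij_betw ?h ?B ?T"
    proof (rule bij_betw_byWitness[of _ ?g])
      show "\<forall>F\<in>?B. ?g (?h F) = F"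
      proof
        fix F assume F: "F \<in> ?B"
        show "?g (?h F) = F"
        proof (cases "top_space F = V")
          case True
          then obtain G w where "F = G @ [(V, w)]" "w > 0" using snocT F by blast
          then show ?thesis by simp
        qed simp
      qed
      show "\<forall>F\<in>?T. ?h (?g F) = F"
      proof
        fix F assume "F \<in> ?T"
        then obtain G w where "F = G @ [(V, w)]" "top_space G \<subset> V" "w > 0" using snocT by blast
        then show "?h (?g F) = F" by auto
      qed
      show "?h ` ?B \<subseteq> ?T"
      proof (rule image_subsetI)
        fix F assume F: "F \<in> ?B"
        show "?h F \<in> ?T"
        proof (cases "top_space F = V")
          case True
          then obtain G w where "F = G @ [(V, w)]" "weighted_flag G" "top_space G \<subset> V" using snocT F by blast
          then show ?thesis using V by (simp add: weighted_flag_snoc)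
        next
          case False
          then show ?thesis using F V by (auto simp: weighted_flag_snoc)
        qed
      qed
      show "?g ` ?T \<subseteq> ?B"
      proof (rule image_subsetI)
        fix F assume "F \<in> ?T"
        then obtain G w where "F = G @ [(V, w)]" "weighted_flag G" "top_space G \<subset> V" "w > 0" using snocT by blast
        then show "?g F \<in> ?B" using V by (auto simp: weighted_flag_snoc)
      qed
    qed
    fix F assume F: "F \<in> ?B"
    show "flag_weight (?h F) = vec.dim V + flag_weight F"
    proof (cases "top_space F = V")
      case True
      then obtain G w where "F = G @ [(V, w)]" using snocT F by blast
      then show ?thesis by simp
    qed simp
  qed simp
  then show ?thesis by (simp add: gf_shift)
qed

text \<open>Splitting by the top W \<subseteq> V gives G(V) as the sum of t^(dim W) G(W), the form
  of \<open>word_gf_recursion\<close> once its coefficients are read as numbers of subspaces. Moving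
  the term W = V to the left leaves the factor 1 - t^k, which can be cancelled for k > 0.\<close>

lemma gf_flags_below:
  fixes V :: "('a::{field,finite} ^ ('d::finite + 'd)) set"
  assumes "isotropic V"
  shows "gf {F. weighted_flag F \<and> top_space F \<subseteq> V} flag_weight (\<lambda>_. 1) = word_gf (of_nat CARD('a)) (vec.dim V)"
  using assms
proof (induction "vec.dim V" arbitrary: V rule: less_induct)
  case less
  let ?q = "of_nat CARD('a) :: rat"
  let ?k = "vec.dim V"
  let ?G = "\<lambda>V. gf {F :: (('a ^ ('d + 'd)) set \<times> nat) list. weighted_flag F \<and> top_space F \<subseteq> V} flag_weight (\<lambda>_. 1)"
  let ?K = "{W. vec.subspace W \<and> W \<subseteq> V}"
  have V: "vec.subspace V" using less.prems by (simp add: isotropic_def)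
  have iso: "isotropic W" if "W \<in> ?K" for W using that isotropic_subset[OF less.prems] by auto
  have "?G V = (\<Sum>W\<in>?K. gf {F\<in>{F. weighted_flag F \<and> top_space F \<subseteq> V}. top_space F = W} flag_weight (\<lambda>_. 1))"
  proof (rule gf_partition)
    show "finite_fibres {F :: (('a ^ ('d + 'd)) set \<times> nat) list. weighted_flag F \<and> top_space F \<subseteq> V} flag_weight"
      by (rule finite_fibres_subset[OF finite_fibres_weighted_flags]) auto
    show "top_space ` {F. weighted_flag F \<and> top_space F \<subseteq> V} \<subseteq> ?K"
      using isotropic_top_space by (auto simp: isotropic_def)
  qed simp
  also have "\<dots> = (\<Sum>W\<in>?K. fps_X ^ vec.dim W * ?G W)"
  proof (rule sum.cong[OF refl])
    fix W assume W: "W \<in> ?K"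
    then have "{F\<in>{F. weighted_flag F \<and> top_space F \<subseteq> V}. top_space F = W} = {F. weighted_flag F \<and> top_space F = W}"
      by auto
    then show "gf {F\<in>{F. weighted_flag F \<and> top_space F \<subseteq> V}. top_space F = W} flag_weight (\<lambda>_. 1) = fps_X ^ vec.dim W * ?G W"
      using gf_fixed_top[OF iso[OF W]] by simp
  qed
  also have "\<dots> = fps_X ^ ?k * ?G V + (\<Sum>W\<in>?K - {V}. fps_X ^ vec.dim W * ?G W)"
    using V by (subst sum.remove[of _ V]) auto
  also have "(\<Sum>W\<in>?K - {V}. fps_X ^ vec.dim W * ?G W) = (\<Sum>W\<in>?K - {V}. fps_X ^ vec.dim W * word_gf ?q (vec.dim W))"
  proof (rule sum.cong[OF refl])
    fix W assume W: "W \<in> ?K - {V}"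
    then have "vec.dim W < vec.dim V"
      using V vec.subspace_dim_equal[of W V] by (cases "vec.dim V \<le> vec.dim W") auto
    then show "fps_X ^ vec.dim W * ?G W = fps_X ^ vec.dim W * word_gf ?q (vec.dim W)"
      using less.hyps[of W] iso[of W] W by simp
  qed
  finally have G: "?G V = fps_X ^ ?k * ?G V + (\<Sum>W\<in>?K - {V}. fps_X ^ vec.dim W * word_gf ?q (vec.dim W))" .
  have "word_gf ?q ?k = (\<Sum>j\<le>?k. fps_const (signs_gf ?q (?k - j) j 0) * fps_X ^ j * word_gf ?q j)"
    by (rule word_gf_recursion)
  also have "\<dots> = (\<Sum>j\<le>?k. \<Sum>W\<in>{W. W \<in> ?K \<and> vec.dim W = j}. fps_X ^ vec.dim W * word_gf ?q (vec.dim W))"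
  proof (rule sum.cong[OF refl])
    fix j assume "j \<in> {..?k}"
    moreover have "{W. W \<in> ?K \<and> vec.dim W = j} = {W. vec.subspace W \<and> W \<subseteq> V \<and> vec.dim W = j}" by auto
    ultimately have "fps_const (signs_gf ?q (?k - j) j 0) = of_nat (card {W. W \<in> ?K \<and> vec.dim W = j})"
      using card_subspaces_signs_gf[OF V, of j ?q] by (simp add: fps_of_nat[symmetric])
    then show "fps_const (signs_gf ?q (?k - j) j 0) * fps_X ^ j * word_gf ?q j
        = (\<Sum>W\<in>{W. W \<in> ?K \<and> vec.dim W = j}. fps_X ^ vec.dim W * word_gf ?q (vec.dim W))"
      by (simp add: mult.assoc)
  qed
  also have "\<dots> = (\<Sum>W\<in>?K. fps_X ^ vec.dim W * word_gf ?q (vec.dim W))"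
    using vec.dim_subset by (intro sum.group) auto
  also have "\<dots> = fps_X ^ ?k * word_gf ?q ?k + (\<Sum>W\<in>?K - {V}. fps_X ^ vec.dim W * word_gf ?q (vec.dim W))"
    using V by (subst sum.remove[of _ V]) auto
  finally have A: "word_gf ?q ?k = fps_X ^ ?k * word_gf ?q ?k + (\<Sum>W\<in>?K - {V}. fps_X ^ vec.dim W * word_gf ?q (vec.dim W))" .
  show ?case
  proof (cases "?k = 0")
    case True
    \<comment> \<open>At k = 0 the recursion carries no information; the empty flag is the only
      one.\<close>
    then have "V = {0}" using dim_isotropic_pos[OF less.prems] by (metis less_irrefl)
    then have "{F. weighted_flag F \<and> top_space F \<subseteq> V} = {[]}"
      using isotropic_top_space top_space_eq_zero vec.subspace_0 by (fastforce simp: isotropic_def)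
    then show ?thesis unfolding True by (simp add: word_gf_def gf_singleton)
  next
    case False
    let ?R = "\<Sum>W\<in>?K - {V}. fps_X ^ vec.dim W * word_gf ?q (vec.dim W)"
    have "?G V - fps_X ^ ?k * ?G V = ?R"
      by (rule diff_eq_eq[THEN iffD2, OF trans[OF G add.commute]])
    moreover have "word_gf ?q ?k - fps_X ^ ?k * word_gf ?q ?k = ?R"
      by (rule diff_eq_eq[THEN iffD2, OF trans[OF A add.commute]])
    ultimately have "(1 - fps_X ^ ?k) * ?G V = (1 - fps_X ^ ?k) * word_gf ?q ?k"
      by (simp only: left_diff_distrib mult_1)
    moreover have "fps_nth (1 - fps_X ^ ?k :: rat fps) 0 = 1" using False by simp
    then have "1 - fps_X ^ ?k \<noteq> (0 :: rat fps)" by (metis fps_zero_nth zero_neq_one)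
    ultimately show ?thesis using mult_left_cancel by blast
  qed
qed

theorem theorem4p2:
  fixes q d :: nat
    and I :: "('a::{field,finite} ^ ('d::finite + 'd)) set"
  assumes "CARD('a) = q" and "odd q" and "CARD('d) = d"
    and "isotropic I" and "vec.dim I = d"
  shows "((\<lambda>F. fps_X ^ flag_weight F) has_sum
           (M_D q d * (\<Prod>j=1..d. 1 / (1 - fps_X ^ j)))) (weighted_even_flags I)"
proof -
  let ?q = "of_nat q :: rat"
  let ?E = "weighted_even_flags I"
  let ?V = "{V. isotropic V \<and> even (vec.dim V - vec.dim (V \<inter> I))}"
  let ?K = "{(p, m). p + m \<le> d \<and> even m}"
  let ?t = "\<lambda>V. (vec.dim (V \<inter> I), vec.dim V - vec.dim (V \<inter> I))"
  let ?A = "\<lambda>k. fps_X ^ k * word_gf ?q k"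
  have fin: "finite_fibres ?E flag_weight"
    by (rule finite_fibres_subset[OF finite_fibres_weighted_flags]) (auto simp: weighted_even_flags_eq)
  have le: "vec.dim (V \<inter> I) \<le> vec.dim V" for V by (intro vec.dim_subset) auto
  \<comment> \<open>Evenness of a flag depends on its top alone.\<close>
  have "gf ?E flag_weight (\<lambda>_. 1) = (\<Sum>V\<in>?V. gf {F\<in>?E. top_space F = V} flag_weight (\<lambda>_. 1))"
    by (rule gf_partition[OF fin]) (auto simp: weighted_even_flags_eq isotropic_top_space)
  also have "\<dots> = (\<Sum>V\<in>?V. ?A (vec.dim V))"
  proof (rule sum.cong[OF refl])
    fix V assume V: "V \<in> ?V"
    then have "{F\<in>?E. top_space F = V} = {F. weighted_flag F \<and> top_space F = V}"
      by (auto simp: weighted_even_flags_eq)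
    then show "gf {F\<in>?E. top_space F = V} flag_weight (\<lambda>_. 1) = ?A (vec.dim V)"
      using V gf_fixed_top[of V] gf_flags_below[of V] assms(1) by simp
  qed
  \<comment> \<open>The summand sees only dim V = p + m, so V enters through the number of spaces of
    its type.\<close>
  also have "\<dots> = (\<Sum>k\<in>?K. \<Sum>V\<in>{V. V \<in> ?V \<and> ?t V = k}. ?A (vec.dim V))"
  proof (rule sum.group[symmetric])
    show "finite ?K" by (rule finite_subset[of _ "{..d} \<times> {..d}"]) auto
    show "?t ` ?V \<subseteq> ?K"
    proof (rule image_subsetI)
      fix V assume "V \<in> ?V"
      then show "?t V \<in> ?K" using le[of V] dim_isotropic_le[of V] assms(3) by simp
    qed
  qed simp
  also have "\<dots> = (\<Sum>(p, m)\<in>?K. fps_const (signs_gf ?q (d - (p + m)) p m) * fps_X ^ (p + m) * word_gf ?q (p + m))"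
  proof (rule sum.cong[OF refl])
    fix k assume "k \<in> ?K"
    then obtain p m where k: "k = (p, m)" "p + m \<le> d" "even m" by auto
    have "{V. V \<in> ?V \<and> ?t V = k} = iso_subspaces I p m"
    proof (rule set_eqI)
      fix V
      show "V \<in> {V. V \<in> ?V \<and> ?t V = k} \<longleftrightarrow> V \<in> iso_subspaces I p m"
        using k le[of V] by (auto simp: iso_subspaces_def)
    qed
    then have "(\<Sum>V\<in>{V. V \<in> ?V \<and> ?t V = k}. ?A (vec.dim V)) = (\<Sum>V\<in>iso_subspaces I p m. ?A (p + m))"
      by (intro sum.cong) (auto simp: iso_subspaces_def)
    also have "\<dots> = fps_const (of_nat (card (iso_subspaces I p m))) * ?A (p + m)"
      by (simp add: fps_of_nat)
    finally show "(\<Sum>V\<in>{V. V \<in> ?V \<and> ?t V = k}. ?A (vec.dim V))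
        = (case k of (p, m) \<Rightarrow> fps_const (signs_gf ?q (d - (p + m)) p m) * fps_X ^ (p + m) * word_gf ?q (p + m))"
      using card_iso_subspaces_signs_gf[OF assms(4,5,3) k(2)] k(1) assms(1) by (simp add: mult.assoc)
  qed
  \<comment> \<open>With even m as predicate, the expansion of words has exactly these
    terms.\<close>
  also have "\<dots> = M_D q d * (\<Prod>j=1..d. 1 / (1 - fps_X ^ j))"
    unfolding M_D_eq_gf by (rule gf_int_lists[symmetric])
  finally show ?thesis using has_sum_fps_X_power[OF fin] by simp
qed

end
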